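(* Let $k \ge 2$ be an integer and let $\boldsymbol{\alpha} = (\alpha_1, \ldots, \alpha_{k-1}) \in \mathbb{R}^{k-1}$ satisfy $\omega^\times(\boldsymbol{\alpha}) < \frac{k-1}{k-2}$ (for $k=2$ this condition reads $\omega^\times(\boldsymbol{\alpha}) < \infty$). Then there exists $\varepsilon_0 > 0$, depending only on $\boldsymbol{\alpha}$, such that for every $\varepsilon \in (0, \varepsilon_0]$ there exist $N_0 \in \mathbb{N}$ and $c > 0$, depending only on $\boldsymbol{\alpha}$ and $\varepsilon$, with the following property. Let $\boldsymbol{\gamma} = (\gamma_1, \ldots, \gamma_{k-1}) \in \mathbb{R}^{k-1}$, let $N \ge N_0$ be an integer, and let $\boldsymbol{\delta} = (\delta_1, \ldots, \delta_{k-1})$ be real numbers with \[ N^{-\varepsilon} \le \delta_i \le 1 \qquad (1 \le i \le k-1). \] Then there exist $b, A_1, \ldots, A_k, N_1, \ldots, N_k \in \mathbb{N}$ such that the generalised arithmetic progression \[ P = P^+(b; A_1, \ldots, A_k; N_1, \ldots, N_k) \] is proper, is contained in the Bohr set $B_{\boldsymbol{\alpha}}^{\boldsymbol{\gamma}}(N; \boldsymbol{\delta})$, and satisfies \[ |P| \ge c\, \delta_1 \cdots \delta_{k-1} N, \qquad N_i \ge N^{\varepsilon} \quad (1 \le i \le k), \qquad N^{\sqrt{\varepsilon}} \le b \le \frac{N}{10}, \] and \[ \gcd(A_1, \ldots, A_k) = 1. \]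
   Context: $\mathbb{N}$ denotes the positive integers. For $x \in \mathbb{R}$, $\|x\|$ denotes the distance from $x$ to the nearest integer. The multiplicative exponent $\omega^\times(\boldsymbol{\alpha})$ is the supremum (possibly $+\infty$) of the set of real numbers $w$ such that, for infinitely many $n \in \mathbb{N}$, $\| n \alpha_1 \| \cdots \| n \alpha_{k-1} \| < n^{-w}$. The Bohr set is \[ B_{\boldsymbol{\alpha}}^{\boldsymbol{\gamma}}(N; \boldsymbol{\delta}) = \{ n \in \mathbb{Z} : |n| \le N, \ \| n \alpha_i - \gamma_i \| \le \delta_i \ (1 \le i \le k-1) \}. \] For $b, A_1, \ldots, A_k, N_1, \ldots, N_k \in \mathbb{N}$ define \[ P^+(b; A_1, \ldots, A_k; N_1, \ldots, N_k) = \{ b + A_1 n_1 + \cdots + A_k n_k : n_i \in \mathbb{Z},\ 1 \le n_i \le N_i \ (1 \le i \le k)\}. \] This generalised arithmetic progression is called proper if for each of its elements $n$ there is a unique vector $(n_1, \ldots, n_k) \in \mathbb{N}^k$ with $n_i \le N_i$ $(1 \le i \le k)$ and $n = b + A_1 n_1 + \cdots + A_k n_k$. *)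

theory Defs
  imports "HOL-Analysis.Analysis"
begin

text \<open>
  Vectors are functions on \<^typ>\<open>nat\<close>, indexed from 1: those in \<open>\<real>\<^sup>k\<^sup>-\<^sup>1\<close> are read on
  \<open>{1..k - 1}\<close> and those of length \<open>k\<close> on \<open>{1..k}\<close>. Values at other indices are never used.
\<close>

definition nearest_int_dist :: "real \<Rightarrow> real" where
  "nearest_int_dist x = \<bar>x - of_int (round x)\<bar>"

text \<open>The supremum is taken in \<^typ>\<open>ereal\<close>, so that it may be \<open>\<infinity>\<close>; \<open>w\<close> ranges over the reals.\<close>

definition mult_exponent :: "nat \<Rightarrow> (nat \<Rightarrow> real) \<Rightarrow> ereal" where
  "mult_exponent k \<alpha> =
    Sup {ereal w | w. infinite {n::nat. n \<ge> 1 \<and>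
      (\<Prod>i = 1..k - 1. nearest_int_dist (real n * \<alpha> i)) < real n powr (- w)}}"

definition bohr_set ::
    "nat \<Rightarrow> (nat \<Rightarrow> real) \<Rightarrow> (nat \<Rightarrow> real) \<Rightarrow> nat \<Rightarrow> (nat \<Rightarrow> real) \<Rightarrow> int set" where
  "bohr_set k \<alpha> \<gamma> N \<delta> =
    {n. \<bar>n\<bar> \<le> int N \<and> (\<forall>i\<in>{1..k - 1}. nearest_int_dist (of_int n * \<alpha> i - \<gamma> i) \<le> \<delta> i)}"

text \<open>
  Coefficient vectors are taken in the extensional product \<open>\<Pi>\<^sub>E\<close>, which fixes their values
  outside \<open>{1..k}\<close>; otherwise no representation could be unique.
\<close>

definition gap_box :: "nat \<Rightarrow> (nat \<Rightarrow> nat) \<Rightarrow> (nat \<Rightarrow> nat) set" where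
  "gap_box k L = (\<Pi>\<^sub>E i\<in>{1..k}. {1..L i})"

definition gap_value :: "nat \<Rightarrow> nat \<Rightarrow> (nat \<Rightarrow> nat) \<Rightarrow> (nat \<Rightarrow> nat) \<Rightarrow> int" where
  "gap_value k b A n = int b + (\<Sum>i = 1..k. int (A i) * int (n i))"

definition gap :: "nat \<Rightarrow> nat \<Rightarrow> (nat \<Rightarrow> nat) \<Rightarrow> (nat \<Rightarrow> nat) \<Rightarrow> int set" where
  "gap k b A L = {gap_value k b A n | n. n \<in> gap_box k L}"

definition proper_gap :: "nat \<Rightarrow> nat \<Rightarrow> (nat \<Rightarrow> nat) \<Rightarrow> (nat \<Rightarrow> nat) \<Rightarrow> bool" where
  "proper_gap k b A L \<longleftrightarrow>
    (\<forall>m\<in>gap k b A L. \<exists>!n. n \<in> gap_box k L \<and> m = gap_value k b A n)"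

end

theory Submission imports Defs begin

text \<open>
  Put \<open>d = k - 1\<close>. Scale the integer points \<open>(n, m\<^sub>1, \<dots>, m\<^sub>d)\<close> to the lattice \<open>\<Lambda>\<close> of all
  vectors \<open>(n / N, (n \<alpha>\<^sub>1 - m\<^sub>1) / \<delta>\<^sub>1, \<dots>, (n \<alpha>\<^sub>d - m\<^sub>d) / \<delta>\<^sub>d)\<close> in \<open>\<real>\<^sup>k\<close>. Its covolume is \<open>1
  / (N \<Delta>)\<close> with \<open>\<Delta> = \<delta>\<^sub>1 \<cdots> \<delta>\<^sub>d\<close>, and a member of the Bohr set is the same as a lattice point
  close to \<open>(0, \<gamma>\<^sub>1 / \<delta>\<^sub>1, \<dots>, \<gamma>\<^sub>d / \<delta>\<^sub>d)\<close>. The progression is a box in the coordinates of a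
  well-chosen basis \<open>v\<^sub>0, \<dots>, v\<^sub>d\<close> of \<open>\<Lambda>\<close>: \<open>A\<^sub>i\<close> is the absolute value of the integer \<open>n\<close> of
  \<open>v\<^sub>i\<close>, and the length in this direction is about \<open>1 / (2 k \<bar>v\<^sub>i\<bar>)\<close>.

  Two facts make this work. First, every lattice has a basis whose orthogonality defect is
  bounded in terms of the dimension, \<open>\<bar>v\<^sub>0\<bar> \<cdots> \<bar>v\<^sub>d\<bar> \<le> C / (N \<Delta>)\<close> (\<open>reduced_basis\<close>). So a box
  whose sides all have length at least \<open>1\<close> has at least a constant times \<open>N \<Delta>\<close> points.
  Secondly, the exponent condition keeps nonzero lattice vectors away from the origin: it
  provides \<open>w < d / (d - 1)\<close> (any \<open>w\<close> if \<open>d = 1\<close>) and \<open>c > 0\<close> with \<open>\<parallel>n \<alpha>\<^sub>1\<parallel> \<cdots> \<parallel>n \<alpha>\<^sub>d\<parallel> \<ge> c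
  n\<^sup>-\<^sup>w\<close> for all \<open>n \<ge> 1\<close> (\<open>mult_exponent_lower_bound\<close>), and a nonzero lattice vector of norm
  \<open>r < 1\<close> has, up to sign, \<open>1 \<le> n \<le> r N\<close> and \<open>\<parallel>n \<alpha>\<^sub>i\<parallel> \<le> r\<close>, so \<open>c (r N)\<^sup>-\<^sup>w \<le> r\<^sup>d\<close>; hence \<open>r\<close>
  is at least a constant times \<open>N\<^sup>-\<^sup>\<tau>\<close> with \<open>\<tau> = w / (d + w)\<close> (\<open>bohr_vector_norm_ge\<close>). The
  hypothesis on \<open>w\<close> says exactly that \<open>d \<tau> < 1\<close>. Bounding \<open>d\<close> of the \<open>k\<close> factors of \<open>\<bar>v\<^sub>0\<bar> \<cdots>
  \<bar>v\<^sub>d\<bar>\<close> from below shows that the remaining one is at most a constant times \<open>N\<^sup>d\<^sup>\<tau>\<^sup>-\<^sup>1 / \<Delta>\<close>,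
  a negative power of \<open>N\<close> as soon as \<open>\<epsilon>\<close> is small. So every basis vector is short, and the box
  is long in every direction.

  The other requirements follow from \<open>v\<^sub>0, \<dots>, v\<^sub>d\<close> being a basis of short vectors. The \<open>A\<^sub>i\<close>
  are coprime because some lattice vector has \<open>n = 1\<close>. The progression is proper because a
  coincidence of two values is a lattice relation with \<open>n = 0\<close> and norm less than \<open>1\<close>, and the
  only such vector is zero. Rounding real coordinates with respect to the basis puts a lattice
  point near \<open>(1 / 20, \<gamma>\<^sub>1 / \<delta>\<^sub>1, \<dots>, \<gamma>\<^sub>d / \<delta>\<^sub>d)\<close>, and its integer \<open>n\<close> is the base point \<open>b\<close>.
\<close>

section \<open>Integer spans and Gram--Schmidt orthogonalisation\<close>

text \<open>
  A real vector space is a module over the integers; the submodule generated by the vectors of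
  a basis is the lattice that they span.
\<close>

global_interpretation zmod: module "\<lambda>(c::int) (v::'a::real_vector). of_int c *\<^sub>R v"
  defines zspan = zmod.span
  by unfold_locales (simp_all add: scaleR_add_right scaleR_add_left)

lemma zspan_subset_span: "zspan S \<subseteq> span S"
proof
  fix x assume "x \<in> zspan S"
  then show "x \<in> span S"
    by (induction rule: zmod.span_induct_alt)
      (auto intro: span_add span_scale span_base span_zero)
qed

lemma zspan_subset_iff: "zspan S \<subseteq> zspan T \<longleftrightarrow> S \<subseteq> zspan T"
  by (metis zmod.span_superset zmod.span_minimal zmod.subspace_span order_trans)

text \<open>
  The Gram--Schmidt vectors \<open>s\<close> are carried along as data instead of being computed from \<open>b\<close>,
  so that a change of basis only has to exhibit the new pair. The condition is that of a \<open>QR\<close>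
  decomposition: \<open>s\<close> is orthogonal and \<open>b\<close> differs from it by a strictly triangular
  combination. The product of the norms of the \<open>s j\<close> is the covolume of the lattice spanned by
  \<open>b\<close>.
\<close>

definition gram_schmidt :: "nat \<Rightarrow> (nat \<Rightarrow> 'a::real_inner) \<Rightarrow> (nat \<Rightarrow> 'a) \<Rightarrow> bool" where
  "gram_schmidt n b s \<longleftrightarrow>
    (\<forall>j<n. s j \<noteq> 0 \<and> (\<forall>i<j. s i \<bullet> s j = 0) \<and> b j - s j \<in> span (s ` {..<j}))"

lemma gram_schmidtD:
  assumes "gram_schmidt n b s" "j < n"
  shows "s j \<noteq> 0" and "\<And>i. i < j \<Longrightarrow> s i \<bullet> s j = 0" and "b j - s j \<in> span (s ` {..<j})"
  using assms by (auto simp: gram_schmidt_def)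

lemma gram_schmidt_orthogonal:
  assumes "gram_schmidt n b s" "i < n" "j < n" "i \<noteq> j"
  shows "s i \<bullet> s j = 0"
  using assms by (metis gram_schmidtD(2) inner_commute linorder_neqE_nat)

lemma gram_schmidt_mono: "gram_schmidt n b s \<Longrightarrow> m \<le> n \<Longrightarrow> gram_schmidt m b s"
  by (auto simp: gram_schmidt_def)

lemma inner_span_eq_0:
  assumes "x \<in> span S" "\<And>y. y \<in> S \<Longrightarrow> y \<bullet> z = 0"
  shows "x \<bullet> z = 0"
  using assms(1)
  by (induction rule: span_induct_alt) (auto simp: assms(2) inner_add_left)

lemma gram_schmidt_inner_prefix:
  assumes "gram_schmidt n b s" "j < n" "m \<le> j" "x \<in> span (s ` {..<m})"
  shows "x \<bullet> s j = 0"
  using assms(4) by (rule inner_span_eq_0) (use assms in \<open>auto intro: gram_schmidt_orthogonal\<close>)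

lemma gram_schmidt_span:
  assumes "gram_schmidt n b s" "j \<le> n"
  shows "span (b ` {..<j}) = span (s ` {..<j})"
  using assms(2)
proof (induction j)
  case (Suc j)
  then have IH: "span (b ` {..<j}) = span (s ` {..<j})" and diff: "b j - s j \<in> span (s ` {..<j})"
    using assms(1) by (auto simp: gram_schmidt_def)
  have mono: "span (f ` {..<j}) \<subseteq> span (f ` {..<Suc j})" for f :: "nat \<Rightarrow> 'a"
    by (intro span_mono image_mono) auto
  have "b j - s j \<in> span (s ` {..<Suc j})" "s j \<in> span (s ` {..<Suc j})"
    using diff mono[of s] by (blast, blast intro: span_base)
  from span_add[OF this] have 1: "b j \<in> span (s ` {..<Suc j})" by simp
  have "b j - s j \<in> span (b ` {..<Suc j})" "b j \<in> span (b ` {..<Suc j})"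
    using diff mono[of b] IH by (blast, blast intro: span_base)
  from span_diff[OF this(2,1)] have 2: "s j \<in> span (b ` {..<Suc j})" by simp
  have "b ` {..<j} \<subseteq> span (s ` {..<Suc j})" "s ` {..<j} \<subseteq> span (b ` {..<Suc j})"
    using IH span_superset[of "b ` {..<j}"] span_superset[of "s ` {..<j}"] mono[of b] mono[of s]
    by blast+
  then have "b ` {..<Suc j} \<subseteq> span (s ` {..<Suc j})" "s ` {..<Suc j} \<subseteq> span (b ` {..<Suc j})"
    using 1 2 by (simp_all add: lessThan_Suc)
  then show ?case
    by (simp add: span_eq)
qed simp

lemma gram_schmidt_inner_diag:
  assumes "gram_schmidt n b s" "j < n"
  shows "b j \<bullet> s j = s j \<bullet> s j"
  using gram_schmidt_inner_prefix[OF assms order_refl gram_schmidtD(3)[OF assms]]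
  by (simp add: inner_diff_left)

lemma gram_schmidt_inner_upper:
  assumes "gram_schmidt n b s" "j < n" "x \<in> span (b ` {..<j})"
  shows "x \<bullet> s j = 0"
  using gram_schmidt_inner_prefix[OF assms(1,2) order_refl] assms gram_schmidt_span[OF assms(1), of j]
  by auto

lemma gram_schmidt_expand:
  assumes gs: "gram_schmidt n b s" and "m \<le> n" and x: "x \<in> span (s ` {..<m})"
  shows "x = (\<Sum>l<m. ((x \<bullet> s l) / (s l \<bullet> s l)) *\<^sub>R s l)"
  using x
proof (induction rule: span_induct_alt)
  case base
  then show ?case by simp
next
  case (step c z y)
  then obtain i where i: "i < m" "z = s i" by auto
  have "(\<Sum>l<m. (((c *\<^sub>R z + y) \<bullet> s l) / (s l \<bullet> s l)) *\<^sub>R s l)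
      = (\<Sum>l<m. (c * (s i \<bullet> s l) / (s l \<bullet> s l)) *\<^sub>R s l) + (\<Sum>l<m. ((y \<bullet> s l) / (s l \<bullet> s l)) *\<^sub>R s l)"
    unfolding i(2) by (simp add: inner_add_left add_divide_distrib scaleR_add_left sum.distrib)
  also have "(\<Sum>l<m. ((y \<bullet> s l) / (s l \<bullet> s l)) *\<^sub>R s l) = y"
    using step by simp
  also have "(\<Sum>l<m. (c * (s i \<bullet> s l) / (s l \<bullet> s l)) *\<^sub>R s l) = (\<Sum>l<m. if l = i then c *\<^sub>R s i else 0)"
    using gs \<open>m \<le> n\<close> i by (intro sum.cong) (auto simp: gram_schmidt_orthogonal gram_schmidtD(1))
  also have "\<dots> = c *\<^sub>R z" using i by simp
  finally show ?case by simp
qed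

lemma gram_schmidt_norm_square:
  assumes gs: "gram_schmidt n b s" and "m \<le> n" and x: "x \<in> span (s ` {..<m})"
  shows "x \<bullet> x = (\<Sum>l<m. (x \<bullet> s l)\<^sup>2 / (s l \<bullet> s l))"
proof -
  have "x \<bullet> x = x \<bullet> (\<Sum>l<m. ((x \<bullet> s l) / (s l \<bullet> s l)) *\<^sub>R s l)"
    using gram_schmidt_expand[OF assms] by simp
  also have "\<dots> = (\<Sum>l<m. (x \<bullet> s l)\<^sup>2 / (s l \<bullet> s l))"
    by (simp add: inner_sum_right power2_eq_square)
  finally show ?thesis .
qed

lemma gram_schmidt_independent:
  assumes "gram_schmidt n b s" "(\<Sum>i<n. t i *\<^sub>R b i) = 0" "i < n"
  shows "t i = 0"
  using assms
proof (induction n)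
  case (Suc n)
  let ?x = "\<Sum>i<n. t i *\<^sub>R b i"
  have x: "?x \<in> span (b ` {..<n})"
    by (intro span_sum span_scale span_base) auto
  have "?x \<bullet> s n = 0" by (rule gram_schmidt_inner_upper[OF Suc.prems(1) _ x]) simp
  moreover have "(?x + t n *\<^sub>R b n) \<bullet> s n = 0" using Suc.prems(2) by simp
  ultimately have "t n * (s n \<bullet> s n) = 0"
    using gram_schmidt_inner_diag[OF Suc.prems(1), of n] by (simp add: inner_add_left)
  then have "t n = 0" using gram_schmidtD(1)[OF Suc.prems(1), of n] by simp
  then show ?case
    using Suc.IH[OF gram_schmidt_mono[OF Suc.prems(1)]] Suc.prems by (auto simp: less_Suc_eq)
qed simp

lemma finite_int_abs_le: "finite {z::int. \<bar>of_int z\<bar> \<le> (R::real)}"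
proof (rule finite_subset)
  show "{z::int. \<bar>of_int z\<bar> \<le> R} \<subseteq> {-\<lfloor>R\<rfloor>..\<lfloor>R\<rfloor>}"
    by (auto simp: abs_le_iff le_floor_iff) linarith
qed simp

text \<open>
  The inner product with the last Gram--Schmidt vector \<open>s n\<close> is the last integer coordinate
  times \<open>s n \<bullet> s n\<close>, so a bound on the norm leaves finitely many values for this coordinate.
  Removing its contribution changes the norm by a bounded amount and leads to the lattice of
  one dimension less.
\<close>

lemma zspan_discrete:
  assumes "gram_schmidt n b s"
  shows "finite {x \<in> zspan (b ` {..<n}). norm x \<le> R}"
  using assms
proof (induction n arbitrary: R)
  case 0
  show ?case by (rule finite_subset[of _ "{0}"]) auto
next
  case (Suc n)
  have gs: "gram_schmidt n b s" using Suc.prems by (rule gram_schmidt_mono) simp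
  have sn: "norm (s n) > 0" using gram_schmidtD(1)[OF Suc.prems, of n] by simp
  define Z where "Z = {z::int. \<bar>of_int z\<bar> \<le> R / norm (s n)}"
  define Y where "Y = {x \<in> zspan (b ` {..<n}). norm x \<le> R + R / norm (s n) * norm (b n)}"
  have "{x \<in> zspan (b ` {..<Suc n}). norm x \<le> R} \<subseteq> (\<lambda>(z, y). y + of_int z *\<^sub>R b n) ` (Z \<times> Y)"
  proof
    fix x assume x: "x \<in> {x \<in> zspan (b ` {..<Suc n}). norm x \<le> R}"
    then obtain z :: int where y: "x - of_int z *\<^sub>R b n \<in> zspan (b ` {..<n})" (is "?y \<in> _")
      by (auto simp: lessThan_Suc zmod.span_insert)
    then have "?y \<bullet> s n = 0"
      using gram_schmidt_inner_upper[OF Suc.prems, of n] zspan_subset_span by blast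
    then have "x \<bullet> s n = of_int z * (s n \<bullet> s n)"
      using gram_schmidt_inner_diag[OF Suc.prems, of n] by (simp add: inner_diff_left)
    then have "\<bar>of_int z\<bar> * (norm (s n) * norm (s n)) = \<bar>x \<bullet> s n\<bar>"
      by (simp add: abs_mult dot_square_norm power2_eq_square)
    also have "\<dots> \<le> R * norm (s n)"
      using Cauchy_Schwarz_ineq2[of x "s n"] x mult_right_mono[of "norm x" R "norm (s n)"] by auto
    finally have z: "\<bar>of_int z\<bar> \<le> R / norm (s n)" using sn by (simp add: field_simps)
    have "norm ?y \<le> norm x + \<bar>of_int z\<bar> * norm (b n)"
      using norm_triangle_ineq4[of x "of_int z *\<^sub>R b n"] by simp
    also have "\<dots> \<le> R + R / norm (s n) * norm (b n)"
      using x z by (intro add_mono mult_right_mono) auto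
    finally have "?y \<in> Y" using y by (simp add: Y_def)
    then show "x \<in> (\<lambda>(z, y). y + of_int z *\<^sub>R b n) ` (Z \<times> Y)"
      using z by (intro image_eqI[of _ _ "(z, ?y)"]) (auto simp: Z_def)
  qed
  moreover have "finite (Z \<times> Y)"
    using Suc.IH[OF gs] by (simp add: Z_def Y_def finite_int_abs_le)
  ultimately show ?case by (meson finite_subset finite_imageI)
qed

text \<open>
  The quotient \<open>(b j \<bullet> s i) / (s i \<bullet> s i)\<close> is the coefficient of \<open>s i\<close> in \<open>b j\<close>; the condition
  is that these coefficients are at most \<open>1 / 2\<close> in absolute value.
\<close>

definition size_reduced :: "nat \<Rightarrow> (nat \<Rightarrow> 'a::real_inner) \<Rightarrow> (nat \<Rightarrow> 'a) \<Rightarrow> bool" where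
  "size_reduced n b s \<longleftrightarrow> (\<forall>j<n. \<forall>i<j. \<bar>b j \<bullet> s i\<bar> \<le> (s i \<bullet> s i) / 2)"

text \<open>
  The coefficients are rounded off from the last to the first: subtracting a multiple of \<open>b m\<close>
  corrects the coefficient of \<open>s m\<close> and leaves those of the later \<open>s i\<close> as they are.
\<close>

lemma size_reduce_vector:
  assumes gs: "gram_schmidt n b s" and "j < n" "m \<le> j"
  shows "\<exists>v \<in> zspan (b ` {..<j}). \<forall>i. m \<le> i \<and> i < j \<longrightarrow> \<bar>(b j + v) \<bullet> s i\<bar> \<le> (s i \<bullet> s i) / 2"
  using \<open>m \<le> j\<close>
proof (induction m rule: inc_induct)
  case base
  then show ?case by (intro bexI[of _ 0]) (auto intro: zmod.span_zero)
next
  case (step m)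
  then obtain v where v: "v \<in> zspan (b ` {..<j})"
    "\<And>i. Suc m \<le> i \<Longrightarrow> i < j \<Longrightarrow> \<bar>(b j + v) \<bullet> s i\<bar> \<le> (s i \<bullet> s i) / 2" by auto
  have m: "m < n" using step.hyps \<open>j < n\<close> by simp
  have pos: "s m \<bullet> s m > 0" using gram_schmidtD(1)[OF gs m] by simp
  define r where "r = ((b j + v) \<bullet> s m) / (s m \<bullet> s m)"
  define v' where "v' = v - of_int (round r) *\<^sub>R b m"
  have "(b j + v') \<bullet> s m = (r - of_int (round r)) * (s m \<bullet> s m)"
    using pos gram_schmidt_inner_diag[OF gs m]
    by (simp add: v'_def r_def inner_diff_left inner_add_left field_simps)
  then have "\<bar>(b j + v') \<bullet> s m\<bar> = \<bar>r - of_int (round r)\<bar> * (s m \<bullet> s m)"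
    by (simp add: abs_mult)
  also have "\<dots> \<le> (1/2) * (s m \<bullet> s m)"
    using of_int_round_abs_le[of r] by (intro mult_right_mono) (auto simp: abs_minus_commute)
  finally have "\<bar>(b j + v') \<bullet> s m\<bar> \<le> (s m \<bullet> s m) / 2" by simp
  moreover have "(b j + v') \<bullet> s i = (b j + v) \<bullet> s i" if "Suc m \<le> i" "i < j" for i
  proof -
    have "b m \<in> span (b ` {..<i})" using that by (intro span_base) auto
    then have "b m \<bullet> s i = 0"
      using gram_schmidt_inner_upper[OF gs] that \<open>j < n\<close> by simp
    then show ?thesis by (simp add: v'_def inner_diff_left inner_add_left)
  qed
  moreover have "v' \<in> zspan (b ` {..<j})"
    unfolding v'_def
    by (rule zmod.span_diff[OF v(1) zmod.span_scale[OF zmod.span_base]]) (use step.hyps in auto)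
  ultimately have "\<bar>(b j + v') \<bullet> s i\<bar> \<le> (s i \<bullet> s i) / 2" if "m \<le> i" "i < j" for i
    using v(2)[of i] that by (cases "i = m") auto
  with \<open>v' \<in> _\<close> show ?case by blast
qed

lemma size_reduce:
  assumes gs: "gram_schmidt n b s"
  obtains c where "gram_schmidt n c s" "size_reduced n c s" "zspan (c ` {..<n}) = zspan (b ` {..<n})"
proof -
  have "\<exists>v. j < n \<longrightarrow> v \<in> zspan (b ` {..<j}) \<and> (\<forall>i<j. \<bar>(b j + v) \<bullet> s i\<bar> \<le> (s i \<bullet> s i) / 2)" for j
    using size_reduce_vector[OF gs, of j 0] by auto
  then obtain v where v: "\<And>j. j < n \<Longrightarrow> v j \<in> zspan (b ` {..<j})"
    "\<And>i j. j < n \<Longrightarrow> i < j \<Longrightarrow> \<bar>(b j + v j) \<bullet> s i\<bar> \<le> (s i \<bullet> s i) / 2" by metis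
  define c where "c j = b j + v j" for j
  have "b j + v j - s j \<in> span (s ` {..<j})" if "j < n" for j
  proof -
    have "v j \<in> span (s ` {..<j})"
      using v(1)[OF that] zspan_subset_span gram_schmidt_span[OF gs, of j] that by auto
    from span_add[OF gram_schmidtD(3)[OF gs that] this] show ?thesis by (simp add: algebra_simps)
  qed
  then have "gram_schmidt n c s"
    using gs by (auto simp: gram_schmidt_def c_def)
  moreover have "size_reduced n c s"
    using v(2) by (auto simp: size_reduced_def c_def)
  moreover have "zspan (c ` {..<j}) = zspan (b ` {..<j})" if "j \<le> n" for j
    using that
  proof (induction j)
    case (Suc j)
    then have IH: "zspan (c ` {..<j}) = zspan (b ` {..<j})" by simp
    have sub: "zspan (c ` {..<j}) \<subseteq> zspan (c ` {..<Suc j})" "zspan (b ` {..<j}) \<subseteq> zspan (b ` {..<Suc j})"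
      by (intro zmod.span_mono image_mono; auto)+
    have vj: "v j \<in> zspan (b ` {..<Suc j})" "v j \<in> zspan (c ` {..<Suc j})"
      using v(1)[of j] sub Suc.prems IH by auto
    have base: "b j \<in> zspan (b ` {..<Suc j})" "c j \<in> zspan (c ` {..<Suc j})"
      by (simp_all add: zmod.span_base)
    have "c j \<in> zspan (b ` {..<Suc j})"
      using zmod.span_add[OF base(1) vj(1)] by (simp add: c_def)
    moreover have "c j - v j \<in> zspan (c ` {..<Suc j})"
      using zmod.span_diff[OF base(2) vj(2)] .
    ultimately have "c j \<in> zspan (b ` {..<Suc j})" "b j \<in> zspan (c ` {..<Suc j})"
      by (simp_all add: c_def)
    moreover have "c ` {..<j} \<subseteq> zspan (b ` {..<Suc j})" "b ` {..<j} \<subseteq> zspan (c ` {..<Suc j})"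
      using IH sub zmod.span_superset[of "c ` {..<j}"] zmod.span_superset[of "b ` {..<j}"] by blast+
    ultimately have "c ` {..<Suc j} \<subseteq> zspan (b ` {..<Suc j})" "b ` {..<Suc j} \<subseteq> zspan (c ` {..<Suc j})"
      by (simp_all add: lessThan_Suc)
    then show ?case using zspan_subset_iff by blast
  qed simp
  ultimately show thesis using that by blast
qed

section \<open>Lattice reduction\<close>

lemma size_reduced_inner_le:
  assumes gs: "gram_schmidt n b s" and sr: "size_reduced n b s" and j: "j < n"
  shows "b j \<bullet> b j \<le> s j \<bullet> s j + (\<Sum>l<j. s l \<bullet> s l) / 4"
proof -
  define u where "u = b j - s j"
  have u: "u \<in> span (s ` {..<j})" unfolding u_def by (rule gram_schmidtD(3)[OF gs j])
  have "u \<bullet> s j = 0" by (rule gram_schmidt_inner_prefix[OF gs j order_refl u])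
  then have "b j \<bullet> b j = s j \<bullet> s j + u \<bullet> u"
    by (simp add: u_def inner_diff_left inner_diff_right inner_commute)
  also have "u \<bullet> u = (\<Sum>l<j. (u \<bullet> s l)\<^sup>2 / (s l \<bullet> s l))"
    by (rule gram_schmidt_norm_square[OF gs less_imp_le[OF j] u])
  also have "\<dots> \<le> (\<Sum>l<j. (s l \<bullet> s l) / 4)"
  proof (rule sum_mono)
    fix l assume "l \<in> {..<j}"
    then have l: "l < j" by simp
    have "s l \<noteq> 0" using gram_schmidtD(1)[OF gs, of l] l j by simp
    have "u \<bullet> s l = b j \<bullet> s l"
      using gram_schmidt_orthogonal[OF gs j, of l] l j by (simp add: u_def inner_diff_left)
    then have "\<bar>u \<bullet> s l\<bar> \<le> (s l \<bullet> s l) / 2" using sr l j by (simp add: size_reduced_def)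
    then have "(u \<bullet> s l)\<^sup>2 \<le> ((s l \<bullet> s l) / 2)\<^sup>2" by (metis abs_ge_zero power2_abs power_mono)
    then show "(u \<bullet> s l)\<^sup>2 / (s l \<bullet> s l) \<le> (s l \<bullet> s l) / 4"
      using \<open>s l \<noteq> 0\<close> by (simp add: field_simps power2_eq_square)
  qed
  finally show ?thesis by (simp add: sum_divide_distrib)
qed

text \<open>
  When two neighbours \<open>b j\<close> and \<open>b (j + 1)\<close> change places, only \<open>s j\<close> and \<open>s (j + 1)\<close> change:
  the new \<open>s j\<close> is the component \<open>p\<close> of \<open>b (j + 1)\<close> orthogonal to the earlier vectors, and the
  next one is the part \<open>q\<close> of the old \<open>s j\<close> orthogonal to \<open>p\<close>. The projections of \<open>b j\<close> and \<open>b
  (j + 1)\<close> orthogonal to the earlier vectors span a parallelogram whose area is the product of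
  the two norms, in either order.
\<close>

lemma gram_schmidt_swap:
  fixes b s :: "nat \<Rightarrow> 'a::real_inner" and j :: nat
  defines "p \<equiv> s (Suc j) + ((b (Suc j) \<bullet> s j) / (s j \<bullet> s j)) *\<^sub>R s j"
  defines "q \<equiv> s j - ((s j \<bullet> p) / (p \<bullet> p)) *\<^sub>R p"
  assumes gs: "gram_schmidt n b s" and j: "Suc j < n"
  shows "gram_schmidt n (b(j := b (Suc j), Suc j := b j)) (s(j := p, Suc j := q))" (is "gram_schmidt n ?b ?s")
    and "norm p * norm q = norm (s j) * norm (s (Suc j))"
proof -
  define \<mu> where "\<mu> = (b (Suc j) \<bullet> s j) / (s j \<bullet> s j)"
  define \<nu> where "\<nu> = (s j \<bullet> p) / (p \<bullet> p)"
  have p: "p = s (Suc j) + \<mu> *\<^sub>R s j" by (simp add: p_def \<mu>_def)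
  have q: "q = s j - \<nu> *\<^sub>R p" by (simp add: q_def \<nu>_def)
  have orth: "s i \<bullet> s l = 0" if "i < n" "l < n" "i \<noteq> l" for i l
    using gram_schmidt_orthogonal[OF gs that] .
  have o: "s j \<bullet> s (Suc j) = 0" "s (Suc j) \<bullet> s j = 0" using orth j by auto
  have nz: "s j \<noteq> 0" "s (Suc j) \<noteq> 0" using gram_schmidtD(1)[OF gs] j by auto
  have p_s1: "p \<bullet> s (Suc j) = s (Suc j) \<bullet> s (Suc j)" by (simp add: p inner_add_left o)
  have p_nz: "p \<noteq> 0" using p_s1 nz by auto
  have q_nz: "q \<noteq> 0"
  proof
    assume "q = 0"
    then have sj: "s j = \<nu> *\<^sub>R p" by (simp add: q)
    then have "\<nu> * (s (Suc j) \<bullet> s (Suc j)) = 0" using o p_s1 by (metis inner_scaleR_left)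
    then have "\<nu> = 0" using nz by simp
    then show False using sj nz by simp
  qed
  have pq: "p \<bullet> q = 0" using p_nz by (simp add: q \<nu>_def inner_diff_right inner_commute)
  have p_prefix: "s l \<bullet> p = 0" and q_prefix: "s l \<bullet> q = 0" if "l < j" for l
    using that j by (simp_all add: q p inner_add_right inner_diff_right orth)
  have p_suffix: "p \<bullet> s l = 0" and q_suffix: "q \<bullet> s l = 0" if "Suc j < l" "l < n" for l
    using that j by (simp_all add: q p inner_add_left inner_diff_left orth)
  have b_p: "b (Suc j) - p \<in> span (s ` {..<j})"
  proof -
    have "b (Suc j) - s (Suc j) \<in> span (s ` {..<Suc j})" by (rule gram_schmidtD(3)[OF gs j])
    then obtain t where t: "b (Suc j) - s (Suc j) - t *\<^sub>R s j \<in> span (s ` {..<j})"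
      by (auto simp: lessThan_Suc span_insert)
    have "(b (Suc j) - s (Suc j) - t *\<^sub>R s j) \<bullet> s j = 0"
      by (rule gram_schmidt_inner_prefix[OF gs _ order_refl t]) (use j in simp)
    then have "b (Suc j) \<bullet> s j = t * (s j \<bullet> s j)" by (simp only: inner_diff_left inner_scaleR_left o)
    then have "t = \<mu>" using nz by (simp add: \<mu>_def)
    then show ?thesis using t by (simp add: p algebra_simps)
  qed
  have prefix: "?s ` {..<i} = s ` {..<i}" if "i \<le> j" for i
    using that by (intro image_cong) auto
  have prefix': "?s ` {..<Suc j} = insert p (s ` {..<j})"
    unfolding lessThan_Suc image_insert prefix[OF order_refl] by simp
  show "gram_schmidt n ?b ?s"
    unfolding gram_schmidt_def
  proof (intro allI impI conjI)
    fix i assume i: "i < n"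
    show "?s i \<noteq> 0" using p_nz q_nz gram_schmidtD(1)[OF gs i] by simp
    show "?s l \<bullet> ?s i = 0" if "l < i" for l
      using that i j pq p_prefix q_prefix p_suffix q_suffix orth by (cases "l < j") auto
    consider "i < j" | "i = j" | "i = Suc j" | "Suc j < i" by linarith
    then show "?b i - ?s i \<in> span (?s ` {..<i})"
    proof cases
      case 1
      then show ?thesis using prefix[of i] gram_schmidtD(3)[OF gs i] by simp
    next
      case 2
      then show ?thesis using prefix[of j] b_p by simp
    next
      case 3
      have "b j - s j \<in> span (insert p (s ` {..<j}))"
        using gram_schmidtD(3)[OF gs, of j] j span_mono[of "s ` {..<j}" "insert p (s ` {..<j})"] by auto
      moreover have "\<nu> *\<^sub>R p \<in> span (insert p (s ` {..<j}))" by (intro span_scale span_base) simp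
      ultimately have "(b j - s j) + \<nu> *\<^sub>R p \<in> span (insert p (s ` {..<j}))" by (rule span_add)
      then show ?thesis using 3 prefix' by (simp add: q algebra_simps)
    next
      case 4
      have "p \<in> span (?s ` {..<i})" "q \<in> span (?s ` {..<i})"
        using 4 by (auto intro!: span_base image_eqI[of _ _ j] image_eqI[of _ _ "Suc j"])
      then have "q + \<nu> *\<^sub>R p \<in> span (?s ` {..<i})" and pp: "p \<in> span (?s ` {..<i})"
        by (auto intro: span_add span_scale)
      then have sj: "s j \<in> span (?s ` {..<i})" by (simp add: q)
      have "p - \<mu> *\<^sub>R s j \<in> span (?s ` {..<i})" using pp sj by (intro span_diff span_scale)
      then have sj1: "s (Suc j) \<in> span (?s ` {..<i})" by (simp add: p)
      have "s l \<in> span (?s ` {..<i})" if "l < i" for l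
      proof (cases "l = j \<or> l = Suc j")
        case False
        then have "s l = ?s l" by simp
        then show ?thesis using that by (metis span_base imageI lessThan_iff)
      qed (use sj sj1 in auto)
      then have "span (s ` {..<i}) \<subseteq> span (?s ` {..<i})" by (intro span_minimal) auto
      then show ?thesis using 4 gram_schmidtD(3)[OF gs i] by auto
    qed
  qed
  have "s j \<bullet> p = \<mu> * (s j \<bullet> s j)" by (simp add: p inner_add_right o)
  moreover have "p \<bullet> p = s (Suc j) \<bullet> s (Suc j) + \<mu>\<^sup>2 * (s j \<bullet> s j)"
    by (simp add: p inner_add_right inner_add_left o power2_eq_square)
  moreover have "(p \<bullet> p) * (q \<bullet> q) = (p \<bullet> p) * (s j \<bullet> s j) - (s j \<bullet> p)\<^sup>2"
    using p_nz by (simp add: q \<nu>_def inner_diff_left inner_diff_right inner_commute field_simps power2_eq_square)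
  ultimately have "(p \<bullet> p) * (q \<bullet> q) = (s j \<bullet> s j) * (s (Suc j) \<bullet> s (Suc j))"
    by (simp add: algebra_simps power2_eq_square)
  then have "(norm p * norm q)\<^sup>2 = (norm (s j) * norm (s (Suc j)))\<^sup>2"
    by (simp add: power_mult_distrib dot_square_norm)
  then show "norm p * norm q = norm (s j) * norm (s (Suc j))"
    by simp
qed

text \<open>
  The search space of the reduction: all bases of the lattice \<open>\<Lambda>\<close> together with their
  Gram--Schmidt vectors. The covolume is recorded as the product \<open>D\<close> of norms: size reduction
  leaves each factor alone, and a swap leaves the product of the two factors that it changes.
\<close>

definition gs_bases :: "nat \<Rightarrow> 'a::real_inner set \<Rightarrow> real \<Rightarrow> ((nat \<Rightarrow> 'a) \<times> (nat \<Rightarrow> 'a)) set" where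
  "gs_bases n \<Lambda> D =
    {(b, s). gram_schmidt n b s \<and> zspan (b ` {..<n}) = \<Lambda> \<and> (\<Prod>i<n. norm (s i)) = D}"

lemma gs_bases_size_reduce:
  assumes "(b, s) \<in> gs_bases n \<Lambda> D"
  obtains c where "(c, s) \<in> gs_bases n \<Lambda> D" "size_reduced n c s"
  using size_reduce[of n b s] assms by (auto simp: gs_bases_def)

lemma gs_bases_swap:
  assumes "(b, s) \<in> gs_bases n \<Lambda> D" and j: "Suc j < n"
  obtains c t where "(c, t) \<in> gs_bases n \<Lambda> D" "\<And>l. l < j \<Longrightarrow> t l = s l"
    "t j = s (Suc j) + ((b (Suc j) \<bullet> s j) / (s j \<bullet> s j)) *\<^sub>R s j"
proof -
  have gs: "gram_schmidt n b s" and \<Lambda>: "zspan (b ` {..<n}) = \<Lambda>" and D: "(\<Prod>i<n. norm (s i)) = D"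
    using assms(1) by (auto simp: gs_bases_def)
  define p where "p = s (Suc j) + ((b (Suc j) \<bullet> s j) / (s j \<bullet> s j)) *\<^sub>R s j"
  define q where "q = s j - ((s j \<bullet> p) / (p \<bullet> p)) *\<^sub>R p"
  define c where "c = b(j := b (Suc j), Suc j := b j)"
  define t where "t = s(j := p, Suc j := q)"
  have gs': "gram_schmidt n c t" and pq: "norm p * norm q = norm (s j) * norm (s (Suc j))"
    using gram_schmidt_swap[OF gs j] unfolding p_def q_def c_def t_def by blast+
  define J where "J = {..<n} - {j, Suc j}"
  have J: "{..<n} = insert j (insert (Suc j) J)" "j \<notin> J" "Suc j \<notin> J" "finite J"
    using j by (auto simp: J_def)
  have "c ` J = b ` J" "(\<Prod>i\<in>J. norm (t i)) = (\<Prod>i\<in>J. norm (s i))"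
    by (rule image_cong prod.cong; auto simp: c_def t_def J_def)+
  moreover have "c j = b (Suc j)" "c (Suc j) = b j" "norm (t j) * norm (t (Suc j)) = norm (s j) * norm (s (Suc j))"
    using pq by (simp_all add: c_def t_def)
  ultimately have "c ` {..<n} = b ` {..<n}" "(\<Prod>i<n. norm (t i)) = (\<Prod>i<n. norm (s i))"
    unfolding J(1) using J(2-4) by (simp_all add: insert_commute mult.assoc[symmetric])
  then have "(c, t) \<in> gs_bases n \<Lambda> D" using gs' \<Lambda> D by (simp add: gs_bases_def)
  then show thesis by (rule that) (auto simp: t_def p_def)
qed

text \<open>
  This is what makes minimisation possible. After size reduction the vector \<open>c m\<close> with \<open>norm
  (t m) \<le> R\<close> has bounded norm and hence, by discreteness, only finitely many values; and \<open>t m\<close>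
  is recovered from \<open>c m\<close> by projecting away the fixed vectors \<open>s l\<close> with \<open>l < m\<close>.
\<close>

lemma gs_bases_norms_discrete:
  assumes bs: "(b, s) \<in> gs_bases n \<Lambda> D" and m: "m < n"
  shows "finite {r. r \<le> R \<and> (\<exists>c t. (c, t) \<in> gs_bases n \<Lambda> D \<and> (\<forall>l<m. t l = s l) \<and> r = norm (t m))}"
    (is "finite ?V")
proof -
  define M where "M = sqrt (R\<^sup>2 + (\<Sum>l<m. s l \<bullet> s l) / 4)"
  define g where "g x = norm (x - (\<Sum>l<m. ((x \<bullet> s l) / (s l \<bullet> s l)) *\<^sub>R s l))" for x
  have "?V \<subseteq> g ` {x \<in> \<Lambda>. norm x \<le> M}"
  proof
    fix r assume "r \<in> ?V"
    then obtain c0 t where c0: "(c0, t) \<in> gs_bases n \<Lambda> D" and eq: "\<And>l. l < m \<Longrightarrow> t l = s l"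
      and r: "r = norm (t m)" "r \<le> R" by auto
    from c0 obtain c where "(c, t) \<in> gs_bases n \<Lambda> D" and sr: "size_reduced n c t"
      by (rule gs_bases_size_reduce)
    then have gs: "gram_schmidt n c t" and \<Lambda>: "zspan (c ` {..<n}) = \<Lambda>"
      by (auto simp: gs_bases_def)
    have sums: "(\<Sum>l<m. t l \<bullet> t l) = (\<Sum>l<m. s l \<bullet> s l)" by (intro sum.cong) (auto simp: eq)
    have "c m \<bullet> c m \<le> R\<^sup>2 + (\<Sum>l<m. s l \<bullet> s l) / 4"
      using size_reduced_inner_le[OF gs sr m, unfolded sums] r power_mono[of "norm (t m)" R 2]
      by (simp add: dot_square_norm)
    then have "norm (c m) \<le> M" unfolding M_def norm_eq_sqrt_inner by (rule real_sqrt_le_mono)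
    moreover have "c m \<in> \<Lambda>" using m by (auto simp flip: \<Lambda> intro: zmod.span_base)
    moreover have "r = g (c m)"
    proof -
      let ?u = "c m - t m"
      have "?u = (\<Sum>l<m. ((?u \<bullet> t l) / (t l \<bullet> t l)) *\<^sub>R t l)"
        by (rule gram_schmidt_expand[OF gs less_imp_le[OF m] gram_schmidtD(3)[OF gs m]])
      also have "\<dots> = (\<Sum>l<m. ((c m \<bullet> s l) / (s l \<bullet> s l)) *\<^sub>R s l)"
      proof (rule sum.cong)
        fix l assume "l \<in> {..<m}"
        then have "t l = s l" "t m \<bullet> t l = 0" using eq gram_schmidt_orthogonal[OF gs m, of l] m by auto
        then show "((?u \<bullet> t l) / (t l \<bullet> t l)) *\<^sub>R t l = ((c m \<bullet> s l) / (s l \<bullet> s l)) *\<^sub>R s l"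
          by (simp add: inner_diff_left)
      qed simp
      finally have "t m = c m - (\<Sum>l<m. ((c m \<bullet> s l) / (s l \<bullet> s l)) *\<^sub>R s l)"
        by (metis diff_diff_eq2 add_diff_cancel_left')
      then show ?thesis unfolding g_def r by (rule arg_cong)
    qed
    ultimately show "r \<in> g ` {x \<in> \<Lambda>. norm x \<le> M}" by blast
  qed
  moreover have "finite {x \<in> \<Lambda>. norm x \<le> M}"
    using zspan_discrete[of n b s] bs by (auto simp: gs_bases_def)
  ultimately show ?thesis by (meson finite_subset finite_imageI)
qed

text \<open>
  Minimise \<open>norm (s 0)\<close>, then \<open>norm (s 1)\<close> among the bases with the same \<open>s 0\<close>, and so on. The
  comparison fixes the earlier \<open>s l\<close> and not the earlier \<open>b l\<close>, so that it survives size
  reduction.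
\<close>

lemma gs_bases_lex_minimal:
  assumes "gs_bases n \<Lambda> D \<noteq> {}" "m \<le> n"
  shows "\<exists>b s. (b, s) \<in> gs_bases n \<Lambda> D \<and>
    (\<forall>i<m. \<forall>c t. (c, t) \<in> gs_bases n \<Lambda> D \<longrightarrow> (\<forall>l<i. t l = s l) \<longrightarrow> norm (s i) \<le> norm (t i))"
  using \<open>m \<le> n\<close>
proof (induction m)
  case 0
  then show ?case using assms(1) by auto
next
  case (Suc m)
  then obtain b s where bs: "(b, s) \<in> gs_bases n \<Lambda> D"
    and min: "\<And>i c t. i < m \<Longrightarrow> (c, t) \<in> gs_bases n \<Lambda> D \<Longrightarrow> (\<And>l. l < i \<Longrightarrow> t l = s l) \<Longrightarrow> norm (s i) \<le> norm (t i)"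
    by (metis Suc_leD)
  define V where "V = {r. r \<le> norm (s m) \<and>
    (\<exists>c t. (c, t) \<in> gs_bases n \<Lambda> D \<and> (\<forall>l<m. t l = s l) \<and> r = norm (t m))}"
  have fin: "finite V" unfolding V_def by (rule gs_bases_norms_discrete[OF bs]) (use Suc.prems in simp)
  have sV: "norm (s m) \<in> V" using bs by (auto simp: V_def)
  have "Min V \<in> V" using fin sV by (intro Min_in) auto
  then obtain c t where ct: "(c, t) \<in> gs_bases n \<Lambda> D" "\<And>l. l < m \<Longrightarrow> t l = s l" "norm (t m) = Min V"
    by (auto simp: V_def)
  have "norm (t i) \<le> norm (t' i)" if "i < Suc m" "(c', t') \<in> gs_bases n \<Lambda> D" "\<And>l. l < i \<Longrightarrow> t' l = t l" for i c' t'
  proof (cases "i < m")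
    case True
    then show ?thesis using min[OF True that(2)] that(3) ct(2) by auto
  next
    case False
    then have i: "i = m" using that(1) by simp
    show ?thesis
    proof (cases "norm (t' m) \<le> norm (s m)")
      case True
      then have "norm (t' m) \<in> V" using that i ct(2) by (auto simp: V_def)
      then show ?thesis using fin ct(3) i by simp
    next
      case False
      then show ?thesis using Min_le[OF fin sV] ct(3) i by simp
    qed
  qed
  then show ?case using ct(1) by blast
qed

text \<open>
  Bounded orthogonality defect, as for LLL-reduced bases. A size-reduced basis with
  lexicographically minimal Gram--Schmidt norms cannot be improved by a swap. This is a form
  of Lovasz' condition, \<open>\<parallel>s j\<parallel>\<^sup>2 \<le> 2 \<parallel>s (j + 1)\<parallel>\<^sup>2\<close>: the norms of the \<open>s j\<close> drop at most
  geometrically. Size reduction then bounds \<open>norm (b j)\<close> by a multiple of \<open>norm (s j)\<close>, and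
  the product of the latter is the covolume.
\<close>

lemma reduced_basis:
  fixes b\<^sub>0 s\<^sub>0 :: "nat \<Rightarrow> 'a::real_inner"
  assumes "gram_schmidt n b\<^sub>0 s\<^sub>0"
  obtains b s where "gram_schmidt n b s" "zspan (b ` {..<n}) = zspan (b\<^sub>0 ` {..<n})"
    "(\<Prod>i<n. norm (b i)) \<le> (2 ^ n) ^ n * (\<Prod>i<n. norm (s\<^sub>0 i))"
proof -
  define \<B> where "\<B> = gs_bases n (zspan (b\<^sub>0 ` {..<n})) (\<Prod>i<n. norm (s\<^sub>0 i))"
  have "(b\<^sub>0, s\<^sub>0) \<in> \<B>" using assms by (simp add: \<B>_def gs_bases_def)
  then obtain b' s where b': "(b', s) \<in> \<B>"
    and min: "\<And>i c t. i < n \<Longrightarrow> (c, t) \<in> \<B> \<Longrightarrow> (\<And>l. l < i \<Longrightarrow> t l = s l) \<Longrightarrow> norm (s i) \<le> norm (t i)"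
    using gs_bases_lex_minimal[of n "zspan (b\<^sub>0 ` {..<n})" "\<Prod>i<n. norm (s\<^sub>0 i)" n]
    unfolding \<B>_def by blast
  from b' obtain b where b: "(b, s) \<in> \<B>" and sr: "size_reduced n b s"
    unfolding \<B>_def by (rule gs_bases_size_reduce)
  then have gs: "gram_schmidt n b s" and \<Lambda>: "zspan (b ` {..<n}) = zspan (b\<^sub>0 ` {..<n})"
    and D: "(\<Prod>i<n. norm (s i)) = (\<Prod>i<n. norm (s\<^sub>0 i))" by (auto simp: \<B>_def gs_bases_def)
  \<comment> \<open>Swapping \<open>j\<close> and \<open>j + 1\<close> keeps the earlier Gram--Schmidt vectors, so minimality applies to it.\<close>
  have lovasz: "s j \<bullet> s j \<le> 2 * (s (Suc j) \<bullet> s (Suc j))" if j: "Suc j < n" for j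
  proof -
    define \<mu> where "\<mu> = (b (Suc j) \<bullet> s j) / (s j \<bullet> s j)"
    from gs_bases_swap[OF b[unfolded \<B>_def] j] obtain c t where ct: "(c, t) \<in> \<B>" "\<And>l. l < j \<Longrightarrow> t l = s l"
      and tj: "t j = s (Suc j) + \<mu> *\<^sub>R s j" unfolding \<B>_def \<mu>_def by blast
    have "norm (s j) \<le> norm (t j)" using min[OF _ ct] j by simp
    then have "s j \<bullet> s j \<le> t j \<bullet> t j" by (simp add: dot_square_norm power_mono)
    also have "\<dots> = s (Suc j) \<bullet> s (Suc j) + \<mu>\<^sup>2 * (s j \<bullet> s j)"
      using gram_schmidt_orthogonal[OF gs, of j "Suc j"] gram_schmidt_orthogonal[OF gs, of "Suc j" j] j
      by (simp add: tj inner_add_right inner_add_left power2_eq_square)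
    finally have *: "s j \<bullet> s j \<le> s (Suc j) \<bullet> s (Suc j) + \<mu>\<^sup>2 * (s j \<bullet> s j)" .
    have "s j \<noteq> 0" using gram_schmidtD(1)[OF gs] j by simp
    then have "\<bar>\<mu>\<bar> \<le> 1/2" using sr j by (simp add: size_reduced_def \<mu>_def field_simps)
    then have "\<mu>\<^sup>2 \<le> (1/2)\<^sup>2" by (metis abs_ge_zero power2_abs power_mono)
    then have "\<mu>\<^sup>2 * (s j \<bullet> s j) \<le> 1/4 * (s j \<bullet> s j)"
      by (intro mult_right_mono) (auto simp: power2_eq_square)
    then show ?thesis using * inner_ge_zero[of "s j"] by linarith
  qed
  have decay: "s i \<bullet> s i \<le> 2 ^ (j - i) * (s j \<bullet> s j)" if "i \<le> j" "j < n" for i j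
    using that
  proof (induction j rule: dec_induct)
    case (step j)
    then have "s i \<bullet> s i \<le> 2 ^ (j - i) * (s j \<bullet> s j)" by simp
    also have "\<dots> \<le> 2 ^ (j - i) * (2 * (s (Suc j) \<bullet> s (Suc j)))"
      using lovasz[of j] step by (intro mult_left_mono) auto
    finally show ?case using step by (simp add: Suc_diff_le mult.assoc)
  qed simp
  have "norm (b j) \<le> 2 ^ n * norm (s j)" if j: "j < n" for j
  proof -
    have "(\<Sum>l<j. s l \<bullet> s l) \<le> (\<Sum>l<j. 2 ^ n * (s j \<bullet> s j))"
    proof (rule sum_mono)
      fix l assume "l \<in> {..<j}"
      then have "s l \<bullet> s l \<le> 2 ^ (j - l) * (s j \<bullet> s j)" using decay[of l j] j by simp
      also have "\<dots> \<le> 2 ^ n * (s j \<bullet> s j)"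
        using j by (intro mult_right_mono power_increasing) auto
      finally show "s l \<bullet> s l \<le> 2 ^ n * (s j \<bullet> s j)" .
    qed
    also have "\<dots> = real j * 2 ^ n * (s j \<bullet> s j)" by simp
    also have "\<dots> \<le> 2 ^ n * 2 ^ n * (s j \<bullet> s j)"
    proof (intro mult_right_mono)
      have "j \<le> 2 ^ n" using j less_exp[of n] by (meson less_imp_le less_trans)
      then show "real j \<le> 2 ^ n" by (metis of_nat_le_iff of_nat_power of_nat_numeral)
    qed auto
    finally have "b j \<bullet> b j \<le> s j \<bullet> s j + 2 ^ n * 2 ^ n * (s j \<bullet> s j) / 4"
      using size_reduced_inner_le[OF gs sr j] by linarith
    also have "\<dots> \<le> (2 ^ n * 2 ^ n) * (s j \<bullet> s j)"
    proof -
      have "2 * 2 \<le> (2 ^ n * 2 ^ n :: real)"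
        using j power_increasing[of 1 n "2::real"] by (intro mult_mono) auto
      from mult_right_mono[OF this, of "s j \<bullet> s j"] show ?thesis
        using inner_ge_zero[of "s j"] by linarith
    qed
    finally have "(norm (b j))\<^sup>2 \<le> (2 ^ n * norm (s j))\<^sup>2"
      by (simp add: dot_square_norm power_mult_distrib power2_eq_square[of "2 ^ n"])
    then show ?thesis by (rule power2_le_imp_le) simp
  qed
  then have "(\<Prod>i<n. norm (b i)) \<le> (\<Prod>i<n. 2 ^ n * norm (s i))" by (intro prod_mono) auto
  also have "\<dots> = (2 ^ n) ^ n * (\<Prod>i<n. norm (s\<^sub>0 i))" by (simp add: prod.distrib D)
  finally show thesis using that gs \<Lambda> by blast
qed

section \<open>An inner product space of unbounded dimension\<close>

text \<open>
  The dimension of the lattice is a number \<open>k\<close> and not a type. The space of finitely supported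
  real sequences has room for the lattices of all dimensions.
\<close>

typedef fin_seq = "{f :: nat \<Rightarrow> real. finite {i. f i \<noteq> 0}}"
  morphisms coord Fin_seq
  by (rule exI[of _ "\<lambda>_. 0"]) simp

setup_lifting type_definition_fin_seq

instantiation fin_seq :: real_vector
begin

lift_definition zero_fin_seq :: fin_seq is "\<lambda>_. 0" by simp

lift_definition plus_fin_seq :: "fin_seq \<Rightarrow> fin_seq \<Rightarrow> fin_seq" is "\<lambda>f g i. f i + g i"
  by (rule finite_subset[OF _ finite_UnI, rotated]; assumption?) auto

lift_definition minus_fin_seq :: "fin_seq \<Rightarrow> fin_seq \<Rightarrow> fin_seq" is "\<lambda>f g i. f i - g i"
  by (rule finite_subset[OF _ finite_UnI, rotated]; assumption?) auto

lift_definition uminus_fin_seq :: "fin_seq \<Rightarrow> fin_seq" is "\<lambda>f i. - f i" by simp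

lift_definition scaleR_fin_seq :: "real \<Rightarrow> fin_seq \<Rightarrow> fin_seq" is "\<lambda>c f i. c * f i"
  by (rule finite_subset) auto

instance
  by standard (transfer; simp add: algebra_simps fun_eq_iff)+

end

instantiation fin_seq :: real_inner
begin

definition inner_fin_seq :: "fin_seq \<Rightarrow> fin_seq \<Rightarrow> real" where
  "inner_fin_seq x y = (\<Sum>i | coord x i \<noteq> 0. coord x i * coord y i)"

definition norm_fin_seq :: "fin_seq \<Rightarrow> real" where
  "norm_fin_seq x = sqrt (inner x x)"

definition sgn_fin_seq :: "fin_seq \<Rightarrow> fin_seq" where
  "sgn_fin_seq x = x /\<^sub>R norm x"

definition dist_fin_seq :: "fin_seq \<Rightarrow> fin_seq \<Rightarrow> real" where
  "dist_fin_seq x y = norm (x - y)"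

definition uniformity_fin_seq :: "(fin_seq \<times> fin_seq) filter" where
  "uniformity_fin_seq = (INF e\<in>{0<..}. principal {(x, y). dist x y < e})"

definition open_fin_seq :: "fin_seq set \<Rightarrow> bool" where
  "open_fin_seq U \<longleftrightarrow> (\<forall>x\<in>U. \<forall>\<^sub>F (x', y) in uniformity. x' = x \<longrightarrow> y \<in> U)"

lemma finite_coord: "finite {i. coord x i \<noteq> 0}"
  using coord[of x] by simp

lemma inner_fin_seq_superset:
  assumes "finite I" "{i. coord x i \<noteq> 0} \<subseteq> I"
  shows "inner x y = (\<Sum>i\<in>I. coord x i * coord y i)"
  unfolding inner_fin_seq_def using assms by (intro sum.mono_neutral_left) auto

instance
proof
  fix x y z :: fin_seq and a :: real and U :: "fin_seq set"
  show "dist x y = norm (x - y)" by (rule dist_fin_seq_def)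
  show "sgn x = x /\<^sub>R norm x" by (rule sgn_fin_seq_def)
  show "uniformity = (INF e\<in>{0<..}. principal {(x, y :: fin_seq). dist x y < e})"
    by (rule uniformity_fin_seq_def)
  show "open U \<longleftrightarrow> (\<forall>x\<in>U. \<forall>\<^sub>F (x', y) in uniformity. x' = x \<longrightarrow> y \<in> U)"
    by (rule open_fin_seq_def)
  show "norm x = sqrt (inner x x)" by (rule norm_fin_seq_def)
  define I where "I = {i. coord x i \<noteq> 0} \<union> {i. coord y i \<noteq> 0}"
  have I: "finite I" "{i. coord x i \<noteq> 0} \<subseteq> I" "{i. coord y i \<noteq> 0} \<subseteq> I"
    by (auto simp: I_def finite_coord)
  note expand = inner_fin_seq_superset[OF I(1)]
  show "inner x y = inner y x" by (simp add: expand I mult.commute)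
  have "{i. coord (x + y) i \<noteq> 0} \<subseteq> I" "{i. coord (a *\<^sub>R x) i \<noteq> 0} \<subseteq> I"
    by (auto simp: I_def plus_fin_seq.rep_eq scaleR_fin_seq.rep_eq)
  then show "inner (x + y) z = inner x z + inner y z" "inner (a *\<^sub>R x) y = a * inner x y"
    by (simp_all add: expand I plus_fin_seq.rep_eq scaleR_fin_seq.rep_eq distrib_right
        sum.distrib sum_distrib_left mult.assoc)
  show "0 \<le> inner x x" by (simp add: inner_fin_seq_def sum_nonneg)
  show "inner x x = 0 \<longleftrightarrow> x = 0"
  proof
    assume "inner x x = 0"
    then have "coord x i = 0" for i
      by (auto simp: inner_fin_seq_def sum_nonneg_eq_0_iff finite_coord)
    then show "x = 0" by transfer (simp add: fun_eq_iff)
  qed (simp add: inner_fin_seq_def zero_fin_seq.rep_eq)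
qed

end

lemma coord_zero [simp]: "coord 0 i = 0"
  and coord_add [simp]: "coord (x + y) i = coord x i + coord y i"
  and coord_diff [simp]: "coord (x - y) i = coord x i - coord y i"
  and coord_scaleR [simp]: "coord (c *\<^sub>R x) i = c * coord x i"
  by (transfer; simp)+

lemma coord_sum [simp]: "coord (sum f A) i = (\<Sum>a\<in>A. coord (f a) i)"
  by (induction A rule: infinite_finite_induct) auto

lemma fin_seq_eqI: "(\<And>i. coord x i = coord y i) \<Longrightarrow> x = y"
  by transfer (simp add: fun_eq_iff)

lift_definition unit_seq :: "nat \<Rightarrow> fin_seq" is "\<lambda>i j. if j = i then 1 else 0"
  by (rule finite_subset[of _ "{_}"]) auto

lemma coord_unit_seq [simp]: "coord (unit_seq i) j = (if j = i then 1 else 0)"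
  by transfer simp

lemma inner_unit_seq [simp]: "unit_seq i \<bullet> x = coord x i"
  by (simp add: inner_fin_seq_def)

lemma norm_unit_seq [simp]: "norm (unit_seq i) = 1"
  by (simp add: norm_eq_sqrt_inner)

lemma unit_seq_nonzero [simp]: "unit_seq i \<noteq> 0"
  by (metis norm_unit_seq norm_zero zero_neq_one)

lemma abs_coord_le_norm: "\<bar>coord x i\<bar> \<le> norm x"
  using Cauchy_Schwarz_ineq2[of "unit_seq i" x] by simp

lemma span_imageD:
  assumes "x \<in> span (f ` {..<n::nat})"
  obtains t where "x = (\<Sum>j<n. t j *\<^sub>R f j)"
proof -
  have "\<exists>t. x = (\<Sum>j<n. t j *\<^sub>R f j)"
    using assms
  proof (induction rule: span_induct_alt)
    case base
    show ?case by (rule exI[of _ "\<lambda>_. 0"]) simp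
  next
    case (step c z y)
    then obtain i t where i: "i < n" "z = f i" and t: "y = (\<Sum>j<n. t j *\<^sub>R f j)" by auto
    have "c *\<^sub>R z + y = (\<Sum>j<n. (if j = i then c *\<^sub>R f j else 0)) + (\<Sum>j<n. t j *\<^sub>R f j)"
      using i t by simp
    also have "\<dots> = (\<Sum>j<n. ((if j = i then c else 0) + t j) *\<^sub>R f j)"
      unfolding sum.distrib[symmetric] by (intro sum.cong) (auto simp: scaleR_add_left)
    finally show ?case by (rule exI[of _ "\<lambda>j. (if j = i then c else 0) + t j"])
  qed
  then show thesis using that by blast
qed

text \<open>
  The reduced basis of the Bohr lattice, in terms of integers: \<open>A j\<close> and \<open>M j\<close> are the integer
  coordinates of the \<open>j\<close>-th basis vector, \<open>r j\<close> its norm. The last three clauses say that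
  these vectors are independent, that the coordinates \<open>A j\<close> generate \<open>\<int>\<close>, and that every real
  target \<open>(y, \<gamma>)\<close> is, after scaling, within \<open>\<Sum> r j\<close> of the lattice.
\<close>

lemma bohr_lattice_basis:
  fixes d :: nat and \<alpha> \<delta> :: "nat \<Rightarrow> real" and N :: real
  assumes N: "N > 0" and \<delta>: "\<And>i. i \<in> {1..d} \<Longrightarrow> \<delta> i > 0"
  obtains A :: "nat \<Rightarrow> int" and r :: "nat \<Rightarrow> real" and M :: "nat \<Rightarrow> nat \<Rightarrow> int" where
    "\<And>j. j \<le> d \<Longrightarrow> \<bar>of_int (A j)\<bar> \<le> r j * N"
    "\<And>j i. j \<le> d \<Longrightarrow> i \<in> {1..d} \<Longrightarrow> \<bar>of_int (A j) * \<alpha> i - of_int (M j i)\<bar> \<le> r j * \<delta> i"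
    "(\<Prod>j\<le>d. r j) \<le> (2 ^ Suc d) ^ Suc d / (N * (\<Prod>i = 1..d. \<delta> i))"
    "\<And>z j. (\<Sum>j\<le>d. z j * A j) = 0 \<Longrightarrow> (\<And>i. i \<in> {1..d} \<Longrightarrow> (\<Sum>j\<le>d. z j * M j i) = 0) \<Longrightarrow> j \<le> d \<Longrightarrow> z j = 0"
    "\<And>g. (\<And>j. j \<le> d \<Longrightarrow> g dvd A j) \<Longrightarrow> g dvd 1"
    "\<And>y \<gamma>. \<exists>a m. \<bar>of_int a - y\<bar> \<le> (\<Sum>j\<le>d. r j) * N \<and>
        (\<forall>i\<in>{1..d}. \<bar>of_int a * \<alpha> i - of_int (m i) - \<gamma> i\<bar> \<le> (\<Sum>j\<le>d. r j) * \<delta> i)"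
proof -
  \<comment> \<open>The vectors with \<open>n = 0\<close> come first: in this order Gram--Schmidt orthogonalisation only
    strips \<open>b0 d\<close> of its last coordinates, and the covolume is a product of diagonal entries.\<close>
  define s0 where "s0 j = (if j < d then (1 / \<delta> (Suc j)) *\<^sub>R unit_seq (Suc j) else (1 / N) *\<^sub>R unit_seq 0)" for j
  define b0 where "b0 j = (if j < d then s0 j else s0 j + (\<Sum>i<d. \<alpha> (Suc i) *\<^sub>R s0 i))" for j
  let ?\<Lambda> = "zspan (b0 ` {..<Suc d})"
  have \<delta>': "\<delta> (Suc i) > 0" if "i < d" for i using \<delta>[of "Suc i"] that by simp
  have gs0: "gram_schmidt (Suc d) b0 s0"
    unfolding gram_schmidt_def
  proof (intro allI impI conjI)
    fix j assume j: "j < Suc d"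
    show "s0 j \<noteq> 0" using N \<delta>'[of j] by (auto simp: s0_def)
    show "s0 i \<bullet> s0 j = 0" if "i < j" for i using that j by (auto simp: s0_def)
    show "b0 j - s0 j \<in> span (s0 ` {..<j})"
    proof (cases "j < d")
      case True
      then show ?thesis by (simp add: b0_def span_zero)
    next
      case False
      with j have "j = d" by simp
      then have "b0 j - s0 j = (\<Sum>i<j. \<alpha> (Suc i) *\<^sub>R s0 i)" by (simp add: b0_def)
      also have "\<dots> \<in> span (s0 ` {..<j})" by (intro span_sum span_scale span_base) simp
      finally show ?thesis .
    qed
  qed
  have D: "(\<Prod>j<Suc d. norm (s0 j)) = 1 / (N * (\<Prod>i = 1..d. \<delta> i))"
  proof -
    have "(\<Prod>j<d. norm (s0 j)) = (\<Prod>j<d. 1 / \<delta> (Suc j))"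
      using \<delta>' by (intro prod.cong) (auto simp: s0_def abs_of_pos)
    also have "\<dots> = 1 / (\<Prod>i = 1..d. \<delta> i)"
      by (simp add: prod_dividef prod.atLeast1_atMost_eq)
    finally show ?thesis using N by (simp add: s0_def)
  qed
  from reduced_basis[OF gs0] obtain b s where gs: "gram_schmidt (Suc d) b s" and \<Lambda>: "zspan (b ` {..<Suc d}) = ?\<Lambda>"
    and prod: "(\<Prod>i<Suc d. norm (b i)) \<le> (2 ^ Suc d) ^ Suc d * (\<Prod>i<Suc d. norm (s0 i))" by blast
  \<comment> \<open>\<open>isvec n m x\<close>: the point \<open>x\<close> is the scaled image of the integer point \<open>(n, m)\<close>.\<close>
  define isvec where "isvec n m x \<longleftrightarrow> coord x 0 = of_int n / N \<and>
      (\<forall>i\<in>{1..d}. coord x i = (of_int n * \<alpha> i - of_int (m i)) / \<delta> i) \<and> (\<forall>i>d. coord x i = 0)"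
    for n :: int and m :: "nat \<Rightarrow> int" and x
  have isvec_add: "isvec (c * n + n') (\<lambda>i. c * m i + m' i) (of_int c *\<^sub>R x + y)"
    if "isvec n m x" "isvec n' m' y" for c n m x n' m' y
  proof -
    have "a * ((x * y - u) / e) + (x' * y - u') / e = ((a * x + x') * y - (a * u + u')) / e"
      for a x y u e x' u' :: real
      by (simp add: add_divide_distrib diff_divide_distrib algebra_simps)
    then show ?thesis using that by (auto simp: isvec_def add_divide_distrib)
  qed
  have isvec_b0: "\<exists>n m. isvec n m (b0 j)" if "j < Suc d" for j
  proof (cases "j < d")
    case True
    then have "isvec 0 (\<lambda>i. if i = Suc j then -1 else 0) (b0 j)"
      by (auto simp: isvec_def b0_def s0_def)
    then show ?thesis by blast
  next
    case False
    with that have j: "j = d" by simp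
    have "coord (\<Sum>i<d. \<alpha> (Suc i) *\<^sub>R s0 i) i = (if i \<in> {1..d} then \<alpha> i / \<delta> i else 0)" for i
    proof -
      have "coord (\<Sum>i<d. \<alpha> (Suc i) *\<^sub>R s0 i) i = (\<Sum>l<d. if Suc l = i then \<alpha> (Suc l) / \<delta> (Suc l) else 0)"
        by (auto simp: s0_def intro!: sum.cong)
      also have "\<dots> = (\<Sum>l\<in>{1..d}. if l = i then \<alpha> l / \<delta> l else 0)"
        by (simp only: One_nat_def sum.atLeast1_atMost_eq)
      finally show ?thesis by simp
    qed
    then have "isvec 1 (\<lambda>_. 0) (b0 j)"
      by (auto simp: isvec_def b0_def s0_def j)
    then show ?thesis by blast
  qed
  have isvec_ex: "\<exists>n m. isvec n m x" if "x \<in> ?\<Lambda>" for x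
    using that
  proof (induction rule: zmod.span_induct_alt)
    case base
    have "isvec 0 (\<lambda>_. 0) 0" by (simp add: isvec_def)
    then show ?case by blast
  next
    case (step c x y)
    then show ?case using isvec_b0 isvec_add by blast
  qed
  have "\<exists>n m. isvec n m (b j)" if "j \<le> d" for j
    using that by (intro isvec_ex) (auto simp flip: \<Lambda> intro: zmod.span_base)
  then obtain A M where AM: "\<And>j. j \<le> d \<Longrightarrow> isvec (A j) (M j) (b j)" by metis
  \<comment> \<open>Each coordinate is at most the norm. The distance to a point \<open>z\<close> with free coordinates
    serves both the basis vectors (\<open>z = 0\<close>) and the approximation of \<open>\<gamma>\<close>.\<close>
  have isvec_bounds: "\<bar>of_int n - y\<bar> \<le> R * N \<and> (\<forall>i\<in>{1..d}. \<bar>of_int n * \<alpha> i - of_int (m i) - \<gamma> i\<bar> \<le> R * \<delta> i)"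
    if "isvec n m x" "norm (x - z) \<le> R" "coord z 0 = y / N" "\<And>i. i \<in> {1..d} \<Longrightarrow> coord z i = \<gamma> i / \<delta> i"
    for n m x z y R \<gamma>
  proof (intro conjI ballI)
    have *: "\<bar>coord (x - z) i\<bar> \<le> R" for i using abs_coord_le_norm[of "x - z" i] that(2) by linarith
    have "\<bar>(of_int n - y) / N\<bar> \<le> R" using *[of 0] that(1,3) by (simp add: isvec_def diff_divide_distrib)
    then show "\<bar>of_int n - y\<bar> \<le> R * N" using N by (simp add: field_simps)
    fix i assume i: "i \<in> {1..d}"
    have "\<bar>(of_int n * \<alpha> i - of_int (m i) - \<gamma> i) / \<delta> i\<bar> \<le> R"
      using *[of i] that(1) that(4)[OF i] i by (simp add: isvec_def diff_divide_distrib)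
    then show "\<bar>of_int n * \<alpha> i - of_int (m i) - \<gamma> i\<bar> \<le> R * \<delta> i" using \<delta>[OF i] by (simp add: field_simps)
  qed
  show thesis
  proof (rule that[of A "\<lambda>j. norm (b j)" M])
    show "\<bar>of_int (A j)\<bar> \<le> norm (b j) * N" if "j \<le> d" for j
      using isvec_bounds[OF AM[OF that], of 0 _ 0 "\<lambda>_. 0"] by simp
    show "\<bar>of_int (A j) * \<alpha> i - of_int (M j i)\<bar> \<le> norm (b j) * \<delta> i" if "j \<le> d" "i \<in> {1..d}" for j i
      using isvec_bounds[OF AM[OF that(1)], of 0 _ 0 "\<lambda>_. 0"] that(2) by simp
    show "(\<Prod>j\<le>d. norm (b j)) \<le> (2 ^ Suc d) ^ Suc d / (N * (\<Prod>i = 1..d. \<delta> i))"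
      using prod unfolding D by (simp only: lessThan_Suc_atMost) simp
    show "z j = 0" if z0: "(\<Sum>j\<le>d. z j * A j) = 0" and zi: "\<And>i. i \<in> {1..d} \<Longrightarrow> (\<Sum>j\<le>d. z j * M j i) = 0"
      and j: "j \<le> d" for z j
    proof -
      have "isvec (\<Sum>j\<in>J. z j * A j) (\<lambda>i. \<Sum>j\<in>J. z j * M j i) (\<Sum>j\<in>J. of_int (z j) *\<^sub>R b j)"
        if "finite J" "J \<subseteq> {..d}" for J
        using that
      proof (induction J)
        case empty
        show ?case by (simp add: isvec_def)
      next
        case (insert x F)
        then show ?case using isvec_add[OF AM insert.IH, of x "z x"] by simp
      qed
      from this[of "{..d}"] have "isvec 0 (\<lambda>i. \<Sum>j\<le>d. z j * M j i) (\<Sum>j\<le>d. of_int (z j) *\<^sub>R b j)"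
        using z0 by simp
      then have "coord (\<Sum>j\<le>d. of_int (z j) *\<^sub>R b j) i = 0" for i
        using zi[of i] by (cases "i = 0"; cases "i \<le> d") (auto simp: isvec_def simp del: coord_sum of_int_sum)
      then have "(\<Sum>j<Suc d. of_int (z j) *\<^sub>R b j) = 0"
        unfolding lessThan_Suc_atMost by (intro fin_seq_eqI) simp
      from gram_schmidt_independent[OF gs this, of j] show ?thesis using j by simp
    qed
    show "g dvd 1" if g: "\<And>j. j \<le> d \<Longrightarrow> g dvd A j" for g
    proof -
      have "\<exists>n. coord x 0 = of_int (g * n) / N" if "x \<in> ?\<Lambda>" for x
        using that unfolding \<Lambda>[symmetric]
      proof (induction rule: zmod.span_induct_alt)
        case base
        show ?case by (rule exI[of _ 0]) simp
      next
        case (step c x y)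
        then obtain j where j: "j \<le> d" "x = b j" by (auto simp: less_Suc_eq_le)
        from step obtain n where n: "coord y 0 = of_int (g * n) / N" by blast
        from g[OF j(1)] obtain a where a: "A j = g * a" by (auto simp: dvd_def)
        have "coord (of_int c *\<^sub>R x + y) 0 = of_int (g * (c * a + n)) / N"
          using AM[OF j(1)] by (simp add: isvec_def j n a add_divide_distrib algebra_simps)
        then show ?case by blast
      qed
      moreover have "b0 d \<in> ?\<Lambda>" by (intro zmod.span_base) auto
      moreover have "coord (b0 d) 0 = 1 / N" by (simp add: b0_def s0_def)
      ultimately obtain n where "1 / N = of_int (g * n) / N" by metis
      then have "of_int (g * n) = (1::real)" using N by simp
      then have "g * n = 1" by (simp only: of_int_eq_1_iff)
      then show ?thesis by (metis dvd_triv_left)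
    qed
    show "\<exists>a m. \<bar>of_int a - y\<bar> \<le> (\<Sum>j\<le>d. norm (b j)) * N \<and>
        (\<forall>i\<in>{1..d}. \<bar>of_int a * \<alpha> i - of_int (m i) - \<gamma> i\<bar> \<le> (\<Sum>j\<le>d. norm (b j)) * \<delta> i)" for y \<gamma>
    proof -
      define x where "x = y *\<^sub>R s0 d + (\<Sum>i<d. \<gamma> (Suc i) *\<^sub>R s0 i)"
      have "coord x 0 = y / N" by (simp add: x_def s0_def)
      have "coord x i = \<gamma> i / \<delta> i" if i: "i \<in> {1..d}" for i
      proof -
        have "coord x i = (\<Sum>l<d. if Suc l = i then \<gamma> (Suc l) / \<delta> (Suc l) else 0)"
          using i by (auto simp: x_def s0_def intro!: sum.cong)
        also have "\<dots> = (\<Sum>l\<in>{1..d}. if l = i then \<gamma> l / \<delta> l else 0)"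
          by (simp only: One_nat_def sum.atLeast1_atMost_eq)
        finally show ?thesis using i by simp
      qed
      have "x \<in> span (s0 ` {..<Suc d})"
        unfolding x_def by (intro span_add span_sum span_scale span_base) auto
      also have "\<dots> = span (b0 ` {..<Suc d})" using gram_schmidt_span[OF gs0, of "Suc d"] by simp
      also have "\<dots> \<subseteq> span (b ` {..<Suc d})"
      proof (rule span_minimal)
        show "b0 ` {..<Suc d} \<subseteq> span (b ` {..<Suc d})"
          using zmod.span_superset[of "b0 ` {..<Suc d}"] zspan_subset_span[of "b ` {..<Suc d}"] \<Lambda> by simp
      qed simp
      finally obtain t where t: "x = (\<Sum>j<Suc d. t j *\<^sub>R b j)" by (rule span_imageD)
      \<comment> \<open>Rounding the real coordinates of the target moves it by at most the sum of the norms.\<close>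
      define v where "v = (\<Sum>j<Suc d. of_int (round (t j)) *\<^sub>R b j)"
      have "v \<in> ?\<Lambda>"
        unfolding v_def \<Lambda>[symmetric] by (intro zmod.span_sum zmod.span_scale zmod.span_base) auto
      then obtain a m where am: "isvec a m v" using isvec_ex by blast
      have "norm (v - x) \<le> (\<Sum>j<Suc d. norm ((of_int (round (t j)) - t j) *\<^sub>R b j))"
        unfolding v_def t sum_subtractf[symmetric] scaleR_diff_left[symmetric] by (rule norm_sum)
      also have "\<dots> \<le> (\<Sum>j<Suc d. norm (b j))"
      proof (rule sum_mono)
        fix j
        have "\<bar>of_int (round (t j)) - t j\<bar> \<le> 1" using of_int_round_abs_le[of "t j"] by linarith
        from mult_right_mono[OF this, of "norm (b j)"]
        show "norm ((of_int (round (t j)) - t j) *\<^sub>R b j) \<le> norm (b j)" by simp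
      qed
      finally show ?thesis
        using isvec_bounds[OF am _ \<open>coord x 0 = y / N\<close> \<open>\<And>i. i \<in> {1..d} \<Longrightarrow> coord x i = \<gamma> i / \<delta> i\<close>]
        unfolding lessThan_Suc_atMost by blast
    qed
  qed
qed

section \<open>From Diophantine exponents to short vectors\<close>

lemma nearest_int_dist_le: "nearest_int_dist x \<le> \<bar>x - of_int m\<bar>"
  unfolding nearest_int_dist_def by (rule round_diff_minimal)

text \<open>
  For \<open>w\<close> above the exponent the lower bound with constant \<open>1\<close> fails for finitely many \<open>n\<close>
  only, and the constant \<open>c\<close> absorbs them. This needs the product to be positive at every \<open>n\<close>:
  if it vanished at some \<open>n\<close>, it would vanish at all multiples of \<open>n\<close>.
\<close>

lemma mult_exponent_lower_bound:
  assumes "mult_exponent k \<alpha> < B" "0 < B"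
  obtains w c where "0 < w" "ereal w < B" "0 < c" "c \<le> 1"
    "\<And>n::nat. n \<ge> 1 \<Longrightarrow> c * real n powr (- w) \<le> (\<Prod>i = 1..k - 1. nearest_int_dist (real n * \<alpha> i))"
proof -
  define P where "P n = (\<Prod>i = 1..k - 1. nearest_int_dist (real n * \<alpha> i))" for n :: nat
  have P_nonneg: "P n \<ge> 0" for n unfolding P_def by (intro prod_nonneg) (simp add: nearest_int_dist_def)
  obtain w where w: "max 0 (mult_exponent k \<alpha>) < ereal w" "ereal w < B"
    using ereal_dense2[of "max 0 (mult_exponent k \<alpha>)" B] assms by auto
  define F where "F = {n::nat. n \<ge> 1 \<and> P n < real n powr (- w)}"
  have fin: "finite F"
  proof (rule ccontr)
    assume "infinite F"
    then have "ereal w \<le> mult_exponent k \<alpha>"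
      unfolding mult_exponent_def F_def P_def by (intro Sup_upper) blast
    then show False using w(1) by (metis max_less_iff_conj not_le)
  qed
  have P_pos: "P n > 0" if n: "n \<ge> 1" for n
  proof (rule ccontr)
    assume "\<not> P n > 0"
    then have "P n = 0" using P_nonneg[of n] by simp
    then obtain i where i: "i \<in> {1..k - 1}" "nearest_int_dist (real n * \<alpha> i) = 0" by (auto simp: P_def)
    have "n * m \<in> F" if m: "m \<ge> 1" for m
    proof -
      have "real n * \<alpha> i = of_int (round (real n * \<alpha> i))" using i(2) by (simp add: nearest_int_dist_def)
      then have "real (n * m) * \<alpha> i = of_int (int m * round (real n * \<alpha> i))"
        by (metis (no_types, opaque_lifting) mult.assoc mult.commute of_int_mult of_int_of_nat_eq of_nat_mult)
      then have "real (n * m) * \<alpha> i - of_int (int m * round (real n * \<alpha> i)) = 0" by (rule right_minus_eq[THEN iffD2])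
      then have "nearest_int_dist (real (n * m) * \<alpha> i) \<le> 0"
        by (metis abs_zero nearest_int_dist_le)
      then have "nearest_int_dist (real (n * m) * \<alpha> i) = 0" by (simp add: nearest_int_dist_def)
      then have "P (n * m) = 0" unfolding P_def using i(1) by (intro prod_zero) auto
      then show ?thesis using n m by (simp add: F_def)
    qed
    then have "(\<lambda>m. n * m) ` {1..} \<subseteq> F" by auto
    moreover have "infinite ((\<lambda>m. n * m) ` {1::nat..})"
      using n infinite_Ici[of "1::nat"] by (subst finite_image_iff) (auto simp: inj_on_def)
    ultimately show False using fin finite_subset by blast
  qed
  define c where "c = Min (insert 1 ((\<lambda>n. P n * real n powr w) ` F))"
  have fin': "finite (insert 1 ((\<lambda>n. P n * real n powr w) ` F))" using fin by simp
  have c: "0 < c" "c \<le> 1"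
    using fin' P_pos unfolding c_def by (auto simp: F_def)
  have "c * real n powr (- w) \<le> P n" if n: "n \<ge> 1" for n
  proof (cases "n \<in> F")
    case True
    then have "c \<le> P n * real n powr w" unfolding c_def by (intro Min_le[OF fin']) auto
    then have "c * real n powr (- w) \<le> P n * real n powr w * real n powr (- w)"
      by (intro mult_right_mono) auto
    also have "\<dots> = P n" using n by (simp add: mult.assoc flip: powr_add)
    finally show ?thesis .
  next
    case False
    then have "real n powr (- w) \<le> P n" using n by (simp add: F_def)
    moreover have "c * real n powr (- w) \<le> 1 * real n powr (- w)" using c by (intro mult_right_mono) auto
    ultimately show ?thesis by simp
  qed
  then show thesis using that[of w c] w c by (simp add: P_def)
qed

text \<open>
  If \<open>a = 0\<close>, the inequalities say that the integers \<open>m i\<close> are smaller than \<open>1\<close> in absolute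
  value.
\<close>

lemma bohr_vector_nonzero:
  fixes a :: int and m :: "nat \<Rightarrow> int" and \<alpha> \<delta> :: "nat \<Rightarrow> real" and r :: real
  assumes "r < 1" and \<delta>: "\<And>i. i \<in> {1..d} \<Longrightarrow> 0 < \<delta> i \<and> \<delta> i \<le> 1"
    and close: "\<And>i. i \<in> {1..d} \<Longrightarrow> \<bar>of_int a * \<alpha> i - of_int (m i)\<bar> \<le> r * \<delta> i"
    and nz: "a \<noteq> 0 \<or> (\<exists>i\<in>{1..d}. m i \<noteq> 0)"
  shows "a \<noteq> 0"
proof
  assume a: "a = 0"
  then obtain i where i: "i \<in> {1..d}" "m i \<noteq> 0" using nz by auto
  have "real_of_int \<bar>m i\<bar> \<le> r * \<delta> i" using close[OF i(1)] a by simp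
  also have "\<dots> < 1 * 1" using \<delta>[OF i(1)] \<open>r < 1\<close> mult_strict_right_mono[of r 1 "\<delta> i"] by linarith
  finally show False using i(2) by linarith
qed

text \<open>
  The integer \<open>n = \<bar>a\<bar>\<close> is at most \<open>r N\<close> and has \<open>nearest_int_dist (n \<alpha> i) \<le> r\<close> for all \<open>i\<close>.
  The lower bound on the product thus becomes \<open>c (r N) powr (- w) \<le> r ^ d\<close>, which is solved
  for \<open>r\<close>.
\<close>

lemma bohr_vector_norm_ge:
  fixes a :: int and m :: "nat \<Rightarrow> int" and N :: nat
  assumes lower: "\<And>n::nat. n \<ge> 1 \<Longrightarrow> c * real n powr (- w) \<le> (\<Prod>i = 1..d. nearest_int_dist (real n * \<alpha> i))"
    and c: "0 < c" "c \<le> 1" and w: "0 < w" and N: "N \<ge> 1"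
    and \<delta>: "\<And>i. i \<in> {1..d} \<Longrightarrow> 0 < \<delta> i \<and> \<delta> i \<le> 1"
    and size: "\<bar>of_int a\<bar> \<le> r * real N"
    and close: "\<And>i. i \<in> {1..d} \<Longrightarrow> \<bar>of_int a * \<alpha> i - of_int (m i)\<bar> \<le> r * \<delta> i"
    and nz: "a \<noteq> 0 \<or> (\<exists>i\<in>{1..d}. m i \<noteq> 0)"
  shows "(c * real N powr (- w)) powr (1 / (real d + w)) \<le> r"
proof (cases "r < 1")
  case False
  have "c * real N powr (- w) \<le> 1 * 1"
    using c w N powr_mono[of "- w" 0 "real N"] by (intro mult_mono) auto
  then have "(c * real N powr (- w)) powr (1 / (real d + w)) \<le> 1 powr (1 / (real d + w))"
    using c w by (intro powr_mono2) auto
  then show ?thesis using False by simp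
next
  case True
  have a: "a \<noteq> 0" by (rule bohr_vector_nonzero[OF True \<delta> close nz])
  define n where "n = nat \<bar>a\<bar>"
  have n: "n \<ge> 1" "real n = \<bar>of_int a\<bar>" using a by (auto simp: n_def)
  have "0 < r * real N" using size n by linarith
  then have r: "r > 0" using N by (simp add: zero_less_mult_iff)
  have "nearest_int_dist (real n * \<alpha> i) \<le> r" if i: "i \<in> {1..d}" for i
  proof -
    have "nearest_int_dist (real n * \<alpha> i) \<le> \<bar>real n * \<alpha> i - of_int (sgn a * m i)\<bar>" by (rule nearest_int_dist_le)
    also have "real n * \<alpha> i - of_int (sgn a * m i) = of_int (sgn a) * (of_int a * \<alpha> i - of_int (m i))"
      using n by (auto simp: sgn_if algebra_simps)
    also have "\<bar>\<dots>\<bar> = \<bar>of_int a * \<alpha> i - of_int (m i)\<bar>" using a by (auto simp: sgn_if)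
    also have "\<dots> \<le> r * \<delta> i" by (rule close[OF i])
    also have "\<dots> \<le> r * 1" using r \<delta>[OF i] by (intro mult_left_mono) auto
    finally show ?thesis by simp
  qed
  then have "(\<Prod>i = 1..d. nearest_int_dist (real n * \<alpha> i)) \<le> (\<Prod>i = 1..d. r)"
    by (intro prod_mono) (auto simp: nearest_int_dist_def)
  also have "\<dots> = r powr d" using r by (simp add: powr_realpow)
  finally have "c * real n powr (- w) \<le> r powr d" using lower[OF n(1)] by linarith
  moreover have "(r * real N) powr (- w) \<le> real n powr (- w)"
    using n size w by (intro powr_mono2') auto
  ultimately have "c * (r * real N) powr (- w) \<le> r powr d"
    using c by (meson mult_left_mono less_imp_le order_trans)
  then have "c * real N powr (- w) * r powr (- w) \<le> r powr d"
    using r by (simp add: powr_mult mult_ac)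
  then have "c * real N powr (- w) * r powr (- w) * r powr w \<le> r powr d * r powr w"
    by (intro mult_right_mono) auto
  then have "c * real N powr (- w) \<le> r powr (real d + w)"
    using r by (simp add: mult.assoc powr_add flip: powr_add[of _ "- w" w])
  then have "(c * real N powr (- w)) powr (1 / (real d + w)) \<le> (r powr (real d + w)) powr (1 / (real d + w))"
    using c w by (intro powr_mono2) auto
  also have "\<dots> = r" using r w by (simp add: powr_powr)
  finally show ?thesis .
qed

section \<open>The progression in the Bohr set\<close>

text \<open>
  A combination of the basis vectors with coefficients bounded by \<open>L\<close> has norm at most \<open>\<Sum> L (j
  + 1) * r j \<le> 1 / 2\<close>. Added to \<open>b\<close>, it therefore stays in the Bohr set. And if such a
  combination has vanishing coordinate \<open>n\<close>, the integers in its other coordinates are smaller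
  than \<open>1\<close>, so that it is zero; applied to the difference of two coefficient vectors this
  gives properness.
\<close>

lemma gap_of_short_vectors:
  fixes d :: nat and A :: "nat \<Rightarrow> int" and M :: "nat \<Rightarrow> nat \<Rightarrow> int" and r :: "nat \<Rightarrow> real" and N b :: nat
    and L :: "nat \<Rightarrow> nat"
  defines "A' \<equiv> \<lambda>i. nat \<bar>A (i - 1)\<bar>"
  assumes A: "\<And>j. j \<le> d \<Longrightarrow> \<bar>of_int (A j)\<bar> \<le> r j * real N" and A_nz: "\<And>j. j \<le> d \<Longrightarrow> A j \<noteq> 0"
    and AM: "\<And>j i. j \<le> d \<Longrightarrow> i \<in> {1..d} \<Longrightarrow> \<bar>of_int (A j) * \<alpha> i - of_int (M j i)\<bar> \<le> r j * \<delta> i"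
    and ind: "\<And>z j. (\<Sum>j\<le>d. z j * A j) = 0 \<Longrightarrow> (\<And>i. i \<in> {1..d} \<Longrightarrow> (\<Sum>j\<le>d. z j * M j i) = 0) \<Longrightarrow>
        j \<le> d \<Longrightarrow> z j = 0"
    and \<delta>: "\<And>i. i \<in> {1..d} \<Longrightarrow> 0 < \<delta> i \<and> \<delta> i \<le> 1"
    and r: "\<And>j. j \<le> d \<Longrightarrow> 0 \<le> r j"
    and L: "(\<Sum>j\<le>d. real (L (Suc j)) * r j) \<le> 1 / 2"
    and b: "real b \<le> real N / 10"
    and b_close: "\<And>i. i \<in> {1..d} \<Longrightarrow> \<exists>m::int. \<bar>real b * \<alpha> i - of_int m - \<gamma> i\<bar> \<le> \<delta> i / 2"
  shows "proper_gap (Suc d) b A' L" "gap (Suc d) b A' L \<subseteq> bohr_set (Suc d) \<alpha> \<gamma> N \<delta>"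
    "card (gap (Suc d) b A' L) = (\<Prod>j\<le>d. L (Suc j))"
proof -
  have shift: "(\<Sum>i = 1..Suc d. f i) = (\<Sum>j\<le>d. f (Suc j))" for f :: "nat \<Rightarrow> int"
    by (simp only: One_nat_def sum.atLeast1_atMost_eq lessThan_Suc_atMost)
  have val: "gap_value (Suc d) b A' n = int b + (\<Sum>j\<le>d. \<bar>A j\<bar> * int (n (Suc j)))" for n
    unfolding gap_value_def shift by (simp add: A'_def)
  have box: "n (Suc j) \<le> L (Suc j)" if "n \<in> gap_box (Suc d) L" "j \<le> d" for n j
    using that by (auto simp: gap_box_def PiE_iff)
  have sum_le: "(\<Sum>j\<le>d. \<bar>z j\<bar> * r j) \<le> 1 / 2" if "\<And>j. j \<le> d \<Longrightarrow> \<bar>z j\<bar> \<le> real (L (Suc j))" for z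
    using that r by (intro order_trans[OF sum_mono L] mult_right_mono) auto
  have comb: "\<bar>(\<Sum>j\<le>d. z j * of_int (A j)) * \<alpha> i - (\<Sum>j\<le>d. z j * of_int (M j i))\<bar> \<le> \<delta> i / 2"
    if i: "i \<in> {1..d}" and z: "\<And>j. j \<le> d \<Longrightarrow> \<bar>z j\<bar> \<le> real (L (Suc j))" for z i
  proof -
    have "(\<Sum>j\<le>d. z j * of_int (A j)) * \<alpha> i - (\<Sum>j\<le>d. z j * of_int (M j i))
        = (\<Sum>j\<le>d. z j * (of_int (A j) * \<alpha> i - of_int (M j i)))"
      by (simp add: sum_distrib_left sum_subtractf algebra_simps)
    also have "\<bar>\<dots>\<bar> \<le> (\<Sum>j\<le>d. \<bar>z j * (of_int (A j) * \<alpha> i - of_int (M j i))\<bar>)" by (rule sum_abs)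
    also have "\<dots> \<le> (\<Sum>j\<le>d. \<bar>z j\<bar> * (r j * \<delta> i))"
      unfolding abs_mult using AM i by (intro sum_mono mult_left_mono) auto
    also have "\<dots> = (\<Sum>j\<le>d. \<bar>z j\<bar> * r j) * \<delta> i" by (simp add: sum_distrib_right mult.assoc)
    also have "\<dots> \<le> 1 / 2 * \<delta> i" using \<delta>[OF i] by (intro mult_right_mono sum_le z) auto
    finally show ?thesis by simp
  qed
  have sgnA: "of_int (sgn (A j)) * of_int (A j) = (of_int \<bar>A j\<bar> :: 'a::ring_1)" for j
    by (auto simp: sgn_if)
  have inj: "inj_on (gap_value (Suc d) b A') (gap_box (Suc d) L)"
  proof (rule inj_onI)
    fix n n' assume n: "n \<in> gap_box (Suc d) L" and n': "n' \<in> gap_box (Suc d) L"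
      and eq: "gap_value (Suc d) b A' n = gap_value (Suc d) b A' n'"
    define z where "z j = sgn (A j) * (int (n (Suc j)) - int (n' (Suc j)))" for j
    have z_le: "\<bar>real_of_int (z j)\<bar> \<le> real (L (Suc j))" if "j \<le> d" for j
      using box[OF n that] box[OF n' that] A_nz[OF that] by (auto simp: z_def sgn_if)
    have "(\<Sum>j\<le>d. z j * A j) = (\<Sum>j\<le>d. \<bar>A j\<bar> * int (n (Suc j))) - (\<Sum>j\<le>d. \<bar>A j\<bar> * int (n' (Suc j)))"
      unfolding sum_subtractf[symmetric] by (intro sum.cong) (auto simp: z_def sgn_if algebra_simps)
    then have zA: "(\<Sum>j\<le>d. z j * A j) = 0" using eq unfolding val by simp
    have "(\<Sum>j\<le>d. z j * M j i) = 0" if i: "i \<in> {1..d}" for i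
    proof -
      have "(\<Sum>j\<le>d. real_of_int (z j) * of_int (A j)) = 0"
        using arg_cong[OF zA, of real_of_int] by simp
      then have "\<bar>\<Sum>j\<le>d. real_of_int (z j) * of_int (M j i)\<bar> \<le> \<delta> i / 2"
        using comb[OF i, of "\<lambda>j. of_int (z j)"] z_le by simp
      then have "\<bar>real_of_int (\<Sum>j\<le>d. z j * M j i)\<bar> < 1" using \<delta>[OF i] by simp
      then show ?thesis by linarith
    qed
    note zM = this
    have "n (Suc j) = n' (Suc j)" if "j \<le> d" for j
    proof -
      have "z j = 0" using ind[OF zA zM that] .
      then show ?thesis using A_nz[OF that] by (simp add: z_def sgn_eq_0_iff)
    qed
    then have "n i = n' i" if "i \<in> {1..Suc d}" for i
      using that by (cases i) auto
    then show "n = n'" using n n' unfolding gap_box_def by (rule PiE_ext[rotated 2])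
  qed
  then show "proper_gap (Suc d) b A' L"
    by (auto simp: proper_gap_def gap_def inj_on_def)
  have "gap (Suc d) b A' L = gap_value (Suc d) b A' ` gap_box (Suc d) L" by (auto simp: gap_def)
  then have "card (gap (Suc d) b A' L) = (\<Prod>i = 1..Suc d. L i)"
    using card_image[OF inj] by (simp add: gap_box_def card_PiE)
  then show "card (gap (Suc d) b A' L) = (\<Prod>j\<le>d. L (Suc j))"
    by (simp only: One_nat_def prod.atLeast1_atMost_eq lessThan_Suc_atMost)
  show "gap (Suc d) b A' L \<subseteq> bohr_set (Suc d) \<alpha> \<gamma> N \<delta>"
  proof
    fix v assume "v \<in> gap (Suc d) b A' L"
    then obtain n where n: "n \<in> gap_box (Suc d) L" and v: "v = gap_value (Suc d) b A' n" by (auto simp: gap_def)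
    define z where "z j = real_of_int (sgn (A j)) * real (n (Suc j))" for j
    have z_le: "\<bar>z j\<bar> \<le> real (L (Suc j))" if "j \<le> d" for j
      using box[OF n that] by (auto simp: z_def sgn_if)
    have v': "real_of_int v = real b + (\<Sum>j\<le>d. z j * of_int (A j))"
      unfolding v val by (auto simp: z_def sgn_if intro!: sum.cong)
    have "\<bar>\<Sum>j\<le>d. z j * of_int (A j)\<bar> \<le> (\<Sum>j\<le>d. \<bar>z j\<bar> * (r j * real N))"
      using A by (intro order_trans[OF sum_abs sum_mono]) (auto simp: abs_mult intro!: mult_left_mono)
    also have "\<dots> = (\<Sum>j\<le>d. \<bar>z j\<bar> * r j) * real N" by (simp add: sum_distrib_right mult.assoc)
    also have "\<dots> \<le> 1 / 2 * real N" by (intro mult_right_mono sum_le z_le) auto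
    finally have "\<bar>real_of_int v\<bar> \<le> real N" using v' b by linarith
    then have "\<bar>v\<bar> \<le> int N" by linarith
    moreover have "nearest_int_dist (of_int v * \<alpha> i - \<gamma> i) \<le> \<delta> i" if "i \<in> {1..d}" for i
    proof -
      from b_close[OF that] obtain m :: int where m: "\<bar>real b * \<alpha> i - of_int m - \<gamma> i\<bar> \<le> \<delta> i / 2" by blast
      define m' where "m' = m + (\<Sum>j\<le>d. sgn (A j) * int (n (Suc j)) * M j i)"
      have m': "real_of_int m' = of_int m + (\<Sum>j\<le>d. z j * of_int (M j i))"
        by (simp add: m'_def z_def)
      have "of_int v * \<alpha> i - \<gamma> i - of_int m' = (real b * \<alpha> i - of_int m - \<gamma> i)
          + ((\<Sum>j\<le>d. z j * of_int (A j)) * \<alpha> i - (\<Sum>j\<le>d. z j * of_int (M j i)))"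
        unfolding v' m' by (simp add: algebra_simps)
      then have "\<bar>of_int v * \<alpha> i - \<gamma> i - of_int m'\<bar> \<le> \<delta> i"
        using m comb[OF that z_le] by linarith
      then show ?thesis using nearest_int_dist_le[of "of_int v * \<alpha> i - \<gamma> i" m'] by linarith
    qed
    ultimately show "v \<in> bohr_set (Suc d) \<alpha> \<gamma> N \<delta>" by (simp add: bohr_set_def)
  qed
qed

text \<open>
  Each of the other \<open>d\<close> factors contributes at least \<open>\<rho>\<close>. With the norms of a reduced basis as
  factors and \<open>\<rho>\<close> a lower bound for the lengths of nonzero lattice vectors, this bounds the
  longest basis vector.
\<close>

lemma factor_le_of_prod_le:
  fixes r :: "nat \<Rightarrow> real"
  assumes \<rho>: "0 < \<rho>" and r: "\<And>j. j \<le> d \<Longrightarrow> \<rho> \<le> r j" and P: "(\<Prod>j\<le>d. r j) \<le> P" and j: "j \<le> d"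
  shows "r j \<le> P / \<rho> ^ d"
proof -
  have "(\<Prod>l\<in>{..d} - {j}. \<rho>) \<le> (\<Prod>l\<in>{..d} - {j}. r l)" using \<rho> r by (intro prod_mono) auto
  then have "r j * \<rho> ^ d \<le> r j * (\<Prod>l\<in>{..d} - {j}. r l)"
    using \<rho> r[OF j] j by (intro mult_left_mono) auto
  also have "\<dots> = (\<Prod>j\<le>d. r j)" using j by (subst prod.remove[of _ j]) auto
  finally show ?thesis using P \<rho> by (simp add: pos_le_divide_eq)
qed

text \<open>
  All choices for one \<open>N\<close>. The exponent \<open>\<theta>\<close> is what remains of \<open>1 - d \<tau>\<close>, with \<open>\<tau> = w / (d +
  w)\<close>, after \<open>d \<epsilon>\<close> has been spent on \<open>\<Delta> \<ge> N powr (- d \<epsilon>)\<close> and \<open>\<epsilon>\<close> on the requirement that the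
  sides have length at least \<open>N powr \<epsilon>\<close>. The base point is sought near \<open>N / 20\<close>; as the
  covering radius is at most \<open>1 / 40\<close>, it lies between \<open>N / 40\<close> and \<open>N / 10\<close>. The bound \<open>N \<ge>
  1600 = 40\<^sup>2\<close> gives \<open>N / 40 \<ge> N powr (1 / 2)\<close>.
\<close>

lemma bohr_gap_exists:
  fixes d N :: nat and \<alpha> \<gamma> \<delta> :: "nat \<Rightarrow> real" and w c \<epsilon> :: real
  defines "k \<equiv> real (Suc d)" and "C \<equiv> (2 ^ Suc d) ^ Suc d"
  defines "K \<equiv> C / (c powr (1 / (real d + w))) ^ d"
    and "\<theta> \<equiv> 1 - real d * w / (real d + w) - (real d + 1) * \<epsilon>"
  assumes lower: "\<And>n::nat. n \<ge> 1 \<Longrightarrow> c * real n powr (- w) \<le> (\<Prod>i = 1..d. nearest_int_dist (real n * \<alpha> i))"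
    and c: "0 < c" "c \<le> 1" and w: "0 < w"
    and \<epsilon>: "0 < \<epsilon>" "\<epsilon> \<le> 1 / 4"
    and N: "1600 \<le> N" and large: "K * real N powr (- \<theta>) \<le> 1 / (40 * k)"
    and \<delta>: "\<And>i. i \<in> {1..d} \<Longrightarrow> real N powr (- \<epsilon>) \<le> \<delta> i \<and> \<delta> i \<le> 1"
  shows "\<exists>(b::nat) (A::nat \<Rightarrow> nat) (L::nat \<Rightarrow> nat).
          b \<ge> 1 \<and> (\<forall>i\<in>{1..Suc d}. A i \<ge> 1 \<and> L i \<ge> 1) \<and>
          proper_gap (Suc d) b A L \<and>
          gap (Suc d) b A L \<subseteq> bohr_set (Suc d) \<alpha> \<gamma> N \<delta> \<and>
          real (card (gap (Suc d) b A L)) \<ge> ((1 / (4 * k)) ^ Suc d / C) * (\<Prod>i = 1..d. \<delta> i) * real N \<and>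
          (\<forall>i\<in>{1..Suc d}. real (L i) \<ge> real N powr \<epsilon>) \<and>
          real N powr sqrt \<epsilon> \<le> real b \<and> real b \<le> real N / 10 \<and>
          Gcd (A ` {1..Suc d}) = 1"
proof -
  have N_pos: "0 < real N" "1 \<le> real N" using N by auto
  have k: "k \<ge> 1" by (simp add: k_def)
  have C: "C > 0" by (simp add: C_def)
  have Ne: "real N powr (- \<epsilon>) > 0" using N_pos by simp
  have \<delta>': "0 < \<delta> i \<and> \<delta> i \<le> 1" if "i \<in> {1..d}" for i
    using \<delta>[OF that] Ne by linarith
  define \<Delta> where "\<Delta> = (\<Prod>i = 1..d. \<delta> i)"
  have \<Delta>: "\<Delta> > 0" unfolding \<Delta>_def using \<delta>' by (intro prod_pos) auto
  obtain A :: "nat \<Rightarrow> int" and r :: "nat \<Rightarrow> real" and M :: "nat \<Rightarrow> nat \<Rightarrow> int" where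
    A: "\<And>j. j \<le> d \<Longrightarrow> \<bar>of_int (A j)\<bar> \<le> r j * real N"
    and AM: "\<And>j i. j \<le> d \<Longrightarrow> i \<in> {1..d} \<Longrightarrow> \<bar>of_int (A j) * \<alpha> i - of_int (M j i)\<bar> \<le> r j * \<delta> i"
    and prod_r: "(\<Prod>j\<le>d. r j) \<le> C / (real N * \<Delta>)"
    and ind: "\<And>z j. (\<Sum>j\<le>d. z j * A j) = 0 \<Longrightarrow> (\<And>i. i \<in> {1..d} \<Longrightarrow> (\<Sum>j\<le>d. z j * M j i) = 0) \<Longrightarrow> j \<le> d \<Longrightarrow> z j = 0"
    and gcd: "\<And>g. (\<And>j. j \<le> d \<Longrightarrow> g dvd A j) \<Longrightarrow> g dvd 1"
    and cover: "\<And>y \<gamma>. \<exists>a m. \<bar>of_int a - y\<bar> \<le> (\<Sum>j\<le>d. r j) * real N \<and>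
        (\<forall>i\<in>{1..d}. \<bar>of_int a * \<alpha> i - of_int (m i) - \<gamma> i\<bar> \<le> (\<Sum>j\<le>d. r j) * \<delta> i)"
    apply (rule bohr_lattice_basis[of "real N" d \<delta> \<alpha>, OF N_pos(1) conjunct1[OF \<delta>'], folded C_def \<Delta>_def], assumption)
    subgoal premises prems for A r M
      by (rule prems(1)) (fact prems)+
    done
  have nz: "A j \<noteq> 0 \<or> (\<exists>i\<in>{1..d}. M j i \<noteq> 0)" if j: "j \<le> d" for j
  proof (rule ccontr)
    assume "\<not> ?thesis"
    then have "(\<Sum>l\<le>d. (if l = j then 1 else 0) * A l) = 0"
      and "\<And>i. i \<in> {1..d} \<Longrightarrow> (\<Sum>l\<le>d. (if l = j then 1 else 0) * M l i) = 0"
      by (auto intro!: sum.neutral)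
    from ind[OF this j] show False by simp
  qed
  define \<rho> where "\<rho> = (c * real N powr (- w)) powr (1 / (real d + w))"
  have \<rho>: "\<rho> > 0" using c N_pos by (simp add: \<rho>_def)
  have \<rho>_le: "\<rho> \<le> r j" if "j \<le> d" for j
    unfolding \<rho>_def using N
    by (intro bohr_vector_norm_ge[OF lower c w _ \<delta>' A[OF that] AM[OF that] nz[OF that]]) auto
  have r_pos: "0 < r j" if "j \<le> d" for j using \<rho> \<rho>_le[OF that] by linarith
  have r_le: "r j * real N powr \<epsilon> \<le> 1 / (40 * k)" if j: "j \<le> d" for j
  proof -
    have "(\<Prod>i = 1..d. real N powr (- \<epsilon>)) \<le> \<Delta>" unfolding \<Delta>_def using \<delta> Ne by (intro prod_mono) auto
    then have "real N powr (- real d * \<epsilon>) \<le> \<Delta>"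
      using N_pos by (simp add: powr_realpow[symmetric] powr_powr mult.commute)
    then have "C / (real N * \<Delta>) \<le> C / (real N * real N powr (- real d * \<epsilon>))"
      using C N_pos \<Delta> by (intro divide_left_mono mult_left_mono mult_pos_pos) auto
    then have "(\<Prod>j\<le>d. r j) \<le> C / (real N * real N powr (- real d * \<epsilon>))"
      using prod_r by linarith
    from factor_le_of_prod_le[OF \<rho> \<rho>_le this j]
    have "r j \<le> C / (real N * real N powr (- real d * \<epsilon>)) / \<rho> ^ d" .
    also have "\<rho> ^ d = (c powr (1 / (real d + w))) ^ d * real N powr (- real d * w / (real d + w))"
      using c N_pos by (simp add: \<rho>_def powr_mult powr_powr power_mult_distrib powr_realpow[symmetric] mult.commute)
    also have "C / (real N * real N powr (- real d * \<epsilon>)) / ((c powr (1 / (real d + w))) ^ d * real N powr (- real d * w / (real d + w)))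
        = K / (real N powr 1 * real N powr (- real d * \<epsilon>) * real N powr (- real d * w / (real d + w)))"
      using N_pos by (simp add: K_def)
    also have "\<dots> = K / real N powr (\<epsilon> + \<theta>)"
      unfolding powr_add[symmetric] by (simp add: \<theta>_def algebra_simps)
    also have "\<dots> = K * real N powr (- (\<epsilon> + \<theta>))" by (simp only: powr_minus divide_inverse)
    finally have "r j * real N powr \<epsilon> \<le> K * real N powr (- (\<epsilon> + \<theta>)) * real N powr \<epsilon>"
      by (intro mult_right_mono) auto
    also have "\<dots> = K * real N powr (- \<theta>)" by (simp add: mult.assoc flip: powr_add)
    finally show ?thesis using large by linarith
  qed
  have Ne1: "1 \<le> real N powr \<epsilon>" using N_pos \<epsilon> by (intro ge_one_powr_ge_zero) auto
  have r_small: "r j \<le> 1 / (40 * k)" if "j \<le> d" for j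
    using r_le[OF that] mult_left_mono[OF Ne1, of "r j"] r_pos[OF that] by linarith
  have sum_r: "(\<Sum>j\<le>d. r j) \<le> 1 / 40"
  proof -
    have "(\<Sum>j\<le>d. r j) \<le> (\<Sum>j\<le>d. 1 / (40 * k))" using r_small by (intro sum_mono) auto
    also have "\<dots> = k * (1 / (40 * k))" by (simp only: sum_constant card_atMost k_def)
    finally show ?thesis using k by simp
  qed
  have A_nz: "A j \<noteq> 0" if "j \<le> d" for j
  proof -
    have "1 / (40 * k) < 1" using k by (simp add: field_simps)
    then have "r j < 1" using r_small[OF that] by linarith
    from bohr_vector_nonzero[OF this \<delta>' AM[OF that] nz[OF that]] show ?thesis .
  qed
  \<comment> \<open>With side lengths at most \<open>x j\<close>, each of the \<open>k\<close> directions uses \<open>1 / (2 * k)\<close> of the total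
    extent \<open>1 / 2\<close>; rounding down costs at most a factor \<open>2\<close>, as \<open>x j \<ge> 20\<close>.\<close>
  define x where "x j = 1 / (2 * k * r j)" for j
  have x_ge: "20 * real N powr \<epsilon> \<le> x j" if "j \<le> d" for j
    using r_le[OF that] r_pos[OF that] k by (simp add: x_def field_simps)
  define L where "L i = nat \<lfloor>x (i - 1)\<rfloor>" for i
  have L: "x j / 2 \<le> real (L (Suc j))" "real (L (Suc j)) \<le> x j" if "j \<le> d" for j
  proof -
    have "x j \<ge> 2" using x_ge[OF that] Ne1 by linarith
    moreover from this have "real (L (Suc j)) = of_int \<lfloor>x j\<rfloor>" by (simp add: L_def)
    ultimately show "x j / 2 \<le> real (L (Suc j))" "real (L (Suc j)) \<le> x j" by linarith+
  qed
  have L_ge: "real N powr \<epsilon> \<le> real (L (Suc j))" if "j \<le> d" for j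
    using L(1)[OF that] x_ge[OF that] Ne1 by linarith
  define A' where "A' = (\<lambda>i. nat \<bar>A (i - 1)\<bar>)"
  obtain a m where a: "\<bar>of_int a - real N / 20\<bar> \<le> (\<Sum>j\<le>d. r j) * real N"
    and am: "\<And>i. i \<in> {1..d} \<Longrightarrow> \<bar>of_int a * \<alpha> i - of_int (m i) - \<gamma> i\<bar> \<le> (\<Sum>j\<le>d. r j) * \<delta> i"
    using cover by blast
  have "(\<Sum>j\<le>d. r j) * real N \<le> 1 / 40 * real N" using sum_r by (intro mult_right_mono) auto
  then have a_bounds: "real N / 40 \<le> of_int a" "of_int a \<le> real N / 10" using a by linarith+
  define b where "b = nat a"
  have "0 < a" using a_bounds(1) N_pos by linarith
  then have b: "real b = of_int a" "b \<ge> 1" by (auto simp: b_def)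
  have b_ge: "real N powr sqrt \<epsilon> \<le> real b"
  proof -
    have "sqrt \<epsilon> \<le> sqrt ((1 / 2)\<^sup>2)" using \<epsilon> by (intro real_sqrt_le_mono) (simp add: power2_eq_square)
    then have "real N powr sqrt \<epsilon> \<le> real N powr (1 / 2)" using N_pos by (intro powr_mono) auto
    also have "\<dots> = sqrt (real N)" by (simp add: powr_half_sqrt)
    also have "\<dots> \<le> real N / 40"
    proof -
      have "40 \<le> sqrt (real N)" by (rule real_le_rsqrt) (use N in simp)
      from mult_right_mono[OF this, of "sqrt (real N)"] show ?thesis by simp
    qed
    finally show ?thesis using a_bounds b by simp
  qed
  have sum_Lr: "(\<Sum>j\<le>d. real (L (Suc j)) * r j) \<le> 1 / 2"
  proof -
    have "real (L (Suc j)) * r j \<le> 1 / (2 * k)" if "j \<le> d" for j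
      using mult_right_mono[OF L(2)[OF that], of "r j"] r_pos[OF that] by (simp add: x_def)
    then have "(\<Sum>j\<le>d. real (L (Suc j)) * r j) \<le> (\<Sum>j\<le>d. 1 / (2 * k))" by (intro sum_mono) auto
    also have "\<dots> = k * (1 / (2 * k))" by (simp only: sum_constant card_atMost k_def)
    finally show ?thesis using k by simp
  qed
  have b_close: "\<exists>m::int. \<bar>real b * \<alpha> i - of_int m - \<gamma> i\<bar> \<le> \<delta> i / 2" if "i \<in> {1..d}" for i
    using am[OF that] mult_right_mono[OF sum_r, of "\<delta> i"] \<delta>'[OF that] unfolding b(1)
    by (intro exI[of _ "m i"]) linarith
  have b_le: "real b \<le> real N / 10" using a_bounds b by simp
  have r_nonneg: "0 \<le> r j" if "j \<le> d" for j using r_pos[OF that] by simp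
  have P: "proper_gap (Suc d) b A' L" "gap (Suc d) b A' L \<subseteq> bohr_set (Suc d) \<alpha> \<gamma> N \<delta>"
    "card (gap (Suc d) b A' L) = (\<Prod>j\<le>d. L (Suc j))"
    unfolding A'_def
    by (rule gap_of_short_vectors[where r = r and M = M and \<alpha> = \<alpha> and \<gamma> = \<gamma> and \<delta> = \<delta> and N = N];
        fact A A_nz AM ind \<delta>' r_nonneg sum_Lr b_le b_close)+
  have "((1 / (4 * k)) ^ Suc d / C) * \<Delta> * real N \<le> (1 / (4 * k)) ^ Suc d / (\<Prod>j\<le>d. r j)"
  proof -
    have "(\<Prod>j\<le>d. r j) > 0" using r_pos by (intro prod_pos) auto
    moreover have "(\<Prod>j\<le>d. r j) * (\<Delta> * real N / C) \<le> 1"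
      using prod_r C N_pos \<Delta> by (simp add: field_simps)
    ultimately have "\<Delta> * real N / C \<le> 1 / (\<Prod>j\<le>d. r j)" by (simp add: field_simps)
    from mult_left_mono[OF this, of "(1 / (4 * k)) ^ Suc d"] show ?thesis using k by (simp add: mult.assoc)
  qed
  also have "\<dots> = (\<Prod>j\<le>d. x j / 2)"
    by (simp add: x_def prod_dividef prod.distrib power_divide power_mult_distrib)
  also have "\<dots> \<le> (\<Prod>j\<le>d. real (L (Suc j)))"
    using L(1) r_pos k by (intro prod_mono) (auto simp: x_def less_imp_le)
  also have "\<dots> = real (card (gap (Suc d) b A' L))" by (simp add: P(3))
  finally have card: "((1 / (4 * k)) ^ Suc d / C) * \<Delta> * real N \<le> real (card (gap (Suc d) b A' L))" .
  have "Gcd (A' ` {1..Suc d}) = 1"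
  proof -
    have "int (Gcd (A' ` {1..Suc d})) dvd A j" if "j \<le> d" for j
    proof -
      have "Gcd (A' ` {1..Suc d}) dvd A' (Suc j)" using that by (intro Gcd_dvd) auto
      then show ?thesis by (simp add: A'_def flip: int_dvd_int_iff)
    qed
    then show ?thesis using gcd[of "int (Gcd (A' ` {1..Suc d}))"] by simp
  qed
  moreover have "A' i \<ge> 1" "real (L i) \<ge> real N powr \<epsilon>" "L i \<ge> 1" if i: "i \<in> {1..Suc d}" for i
  proof -
    obtain j where j: "i = Suc j" "j \<le> d" using i by (cases i) auto
    show "A' i \<ge> 1" using A_nz[OF j(2)] j by (simp add: A'_def)
    show Li: "real (L i) \<ge> real N powr \<epsilon>" using L_ge[OF j(2)] j by simp
    show "L i \<ge> 1" using Li Ne1 by linarith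
  qed
  ultimately show ?thesis
    using P(1,2) card b_ge b_le b(2) unfolding \<Delta>_def by blast
qed

theorem lemma3p1:
  fixes k :: nat and \<alpha> :: "nat \<Rightarrow> real"
  assumes "k \<ge> 2"
    and "if k = 2 then mult_exponent k \<alpha> < \<infinity>
         else mult_exponent k \<alpha> < ereal ((real k - 1) / (real k - 2))"
  shows "\<exists>\<epsilon>\<^sub>0>0. \<forall>\<epsilon>::real. 0 < \<epsilon> \<and> \<epsilon> \<le> \<epsilon>\<^sub>0 \<longrightarrow>
    (\<exists>(N\<^sub>0::nat) (c::real). N\<^sub>0 \<ge> 1 \<and> c > 0 \<and>
      (\<forall>(\<gamma>::nat \<Rightarrow> real) (N::nat) (\<delta>::nat \<Rightarrow> real).
        N \<ge> N\<^sub>0 \<and> (\<forall>i\<in>{1..k - 1}. real N powr (- \<epsilon>) \<le> \<delta> i \<and> \<delta> i \<le> 1) \<longrightarrow>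
        (\<exists>(b::nat) (A::nat \<Rightarrow> nat) (L::nat \<Rightarrow> nat).
          b \<ge> 1 \<and> (\<forall>i\<in>{1..k}. A i \<ge> 1 \<and> L i \<ge> 1) \<and>
          proper_gap k b A L \<and>
          gap k b A L \<subseteq> bohr_set k \<alpha> \<gamma> N \<delta> \<and>
          real (card (gap k b A L)) \<ge> c * (\<Prod>i = 1..k - 1. \<delta> i) * real N \<and>
          (\<forall>i\<in>{1..k}. real (L i) \<ge> real N powr \<epsilon>) \<and>
          real N powr sqrt \<epsilon> \<le> real b \<and> real b \<le> real N / 10 \<and>
          Gcd (A ` {1..k}) = 1)))"
proof -
  obtain d where k: "k = Suc d" and d: "d \<ge> 1" using assms(1) by (cases k) auto
  define B :: ereal where "B = (if k = 2 then \<infinity> else ereal ((real k - 1) / (real k - 2)))"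
  have "mult_exponent k \<alpha> < B" "0 < B" using assms by (auto simp: B_def split: if_splits)
  then obtain w c where w: "0 < w" "ereal w < B" and c: "0 < c" "c \<le> 1"
    and lower: "\<And>n::nat. n \<ge> 1 \<Longrightarrow> c * real n powr (- w) \<le> (\<Prod>i = 1..d. nearest_int_dist (real n * \<alpha> i))"
    using mult_exponent_lower_bound[of k \<alpha> B] unfolding k diff_Suc_1 by blast
  have "real d * w < real d + w"
  proof (cases "k = 2")
    case True
    then show ?thesis using k by simp
  next
    case False
    then have "w < real d / (real d - 1)" "real d > 1" using w k d by (auto simp: B_def)
    then show ?thesis by (simp add: field_simps)
  qed
  then have \<eta>: "0 < 1 - real d * w / (real d + w)" (is "0 < ?\<eta>") using w by (simp add: field_simps)
  have half_less: "y / 2 < y" if "0 < y" for y :: real using that by simp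
  \<comment> \<open>The bound \<open>1 / 4\<close> gives \<open>sqrt \<epsilon> \<le> 1 / 2\<close>; the other one leaves half of the room \<open>1 - d \<tau>\<close>,
    with \<open>\<tau> = w / (d + w)\<close>, for the exponent \<open>\<theta>\<close>.\<close>
  define \<epsilon>\<^sub>0 where "\<epsilon>\<^sub>0 = min (1 / 4) (?\<eta> / (2 * (real d + 1)))"
  have "\<epsilon>\<^sub>0 > 0" using \<eta> by (simp add: \<epsilon>\<^sub>0_def)
  moreover have "\<exists>(N\<^sub>0::nat) (c::real). N\<^sub>0 \<ge> 1 \<and> c > 0 \<and>
      (\<forall>(\<gamma>::nat \<Rightarrow> real) (N::nat) (\<delta>::nat \<Rightarrow> real).
        N \<ge> N\<^sub>0 \<and> (\<forall>i\<in>{1..k - 1}. real N powr (- \<epsilon>) \<le> \<delta> i \<and> \<delta> i \<le> 1) \<longrightarrow>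
        (\<exists>(b::nat) (A::nat \<Rightarrow> nat) (L::nat \<Rightarrow> nat).
          b \<ge> 1 \<and> (\<forall>i\<in>{1..k}. A i \<ge> 1 \<and> L i \<ge> 1) \<and>
          proper_gap k b A L \<and>
          gap k b A L \<subseteq> bohr_set k \<alpha> \<gamma> N \<delta> \<and>
          real (card (gap k b A L)) \<ge> c * (\<Prod>i = 1..k - 1. \<delta> i) * real N \<and>
          (\<forall>i\<in>{1..k}. real (L i) \<ge> real N powr \<epsilon>) \<and>
          real N powr sqrt \<epsilon> \<le> real b \<and> real b \<le> real N / 10 \<and>
          Gcd (A ` {1..k}) = 1))"
    if \<epsilon>: "0 < \<epsilon>" "\<epsilon> \<le> \<epsilon>\<^sub>0" for \<epsilon> :: real
  proof -
    define C :: real where "C = (2 ^ Suc d) ^ Suc d"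
    define K where "K = C / (c powr (1 / (real d + w))) ^ d"
    define \<theta> where "\<theta> = 1 - real d * w / (real d + w) - (real d + 1) * \<epsilon>"
    have "(real d + 1) * \<epsilon> \<le> (real d + 1) * (?\<eta> / (2 * (real d + 1)))"
      using \<epsilon> by (intro mult_left_mono) (auto simp: \<epsilon>\<^sub>0_def)
    also have "\<dots> = ?\<eta> / 2" by (simp add: field_simps)
    also have "\<dots> < ?\<eta>" by (rule half_less[OF \<eta>])
    finally have "\<theta> > 0" by (simp only: \<theta>_def diff_gt_0_iff_gt)
    then have "((\<lambda>N. K * real N powr (- \<theta>)) \<longlongrightarrow> 0) sequentially"
      by (intro tendsto_mult_right_zero tendsto_neg_powr filterlim_real_sequentially) auto
    then have "\<forall>\<^sub>F N in sequentially. K * real N powr (- \<theta>) < 1 / (40 * real (Suc d))"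
      by (rule order_tendstoD) simp
    then obtain N\<^sub>1 where N\<^sub>1: "\<And>N. N \<ge> N\<^sub>1 \<Longrightarrow> K * real N powr (- \<theta>) \<le> 1 / (40 * real (Suc d))"
      by (auto simp: eventually_sequentially intro: less_imp_le)
    have eps: "\<epsilon> \<le> 1 / 4" using \<epsilon> by (simp add: \<epsilon>\<^sub>0_def)
    show ?thesis
    proof (rule exI[of _ "max 1600 N\<^sub>1"], rule exI[of _ "(1 / (4 * real (Suc d))) ^ Suc d / C"],
        intro conjI allI impI)
      show "max 1600 N\<^sub>1 \<ge> 1" by simp
      show "(1 / (4 * real (Suc d))) ^ Suc d / C > 0" by (simp add: C_def)
      fix \<gamma> :: "nat \<Rightarrow> real" and N and \<delta> :: "nat \<Rightarrow> real"
      assume H: "max 1600 N\<^sub>1 \<le> N \<and> (\<forall>i\<in>{1..k - 1}. real N powr - \<epsilon> \<le> \<delta> i \<and> \<delta> i \<le> 1)"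
      then have N: "1600 \<le> N" "N\<^sub>1 \<le> N"
        and \<delta>: "\<And>i. i \<in> {1..d} \<Longrightarrow> real N powr - \<epsilon> \<le> \<delta> i \<and> \<delta> i \<le> 1" by (auto simp: k)
      show "\<exists>(b::nat) (A::nat \<Rightarrow> nat) (L::nat \<Rightarrow> nat).
          b \<ge> 1 \<and> (\<forall>i\<in>{1..k}. A i \<ge> 1 \<and> L i \<ge> 1) \<and>
          proper_gap k b A L \<and>
          gap k b A L \<subseteq> bohr_set k \<alpha> \<gamma> N \<delta> \<and>
          real (card (gap k b A L)) \<ge> (1 / (4 * real (Suc d))) ^ Suc d / C * (\<Prod>i = 1..k - 1. \<delta> i) * real N \<and>
          (\<forall>i\<in>{1..k}. real (L i) \<ge> real N powr \<epsilon>) \<and>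
          real N powr sqrt \<epsilon> \<le> real b \<and> real b \<le> real N / 10 \<and>
          Gcd (A ` {1..k}) = 1"
        unfolding k diff_Suc_1 C_def
        by (rule bohr_gap_exists[OF lower c w(1) \<epsilon>(1) eps N(1) N\<^sub>1[OF N(2), unfolded K_def \<theta>_def C_def] \<delta>])
    qed
  qed
  ultimately show ?thesis by blast
qed

end
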